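(* The Ranking algorithm is $0.5211$-competitive for the Fully Online Matching problem: for every instance (general, not necessarily bipartite, graph together with an arrival/deadline order), the expected size of the matching produced by Ranking (over its random ranks) is at least $0.5211$ times the size of a maximum matching of the underlying graph.
   Context: Fully Online Matching: an undirected graph $G=(V,E)$ is initially unknown. Time proceeds in steps, each being either the arrival of a vertex $v$ (at which point the edges between $v$ and previously-arrived vertices are revealed) or the deadline of a vertex $v$. Each vertex's deadline occurs after its own arrival and after the arrivals of all its neighbours, so all its incident edges are revealed before its deadline. At the deadline of $v$, if $v$ has not already been matched, the algorithm must irrevocably either match $v$ to one of its currently unmatched neighbours or leave $v$ unmatched. The instance (graph and event order) is fixed in advance by an oblivious adversary. An algorithm is $F$-competitive if on every instance the expected size of its matching is at least $F$ times the maximum matching size. Ranking: when a vertex $v$ arrives, draw its rank $y_v$ independently and uniformly from $[0,1)$; at the deadline of $v$, if $v$ is unmatched and has unmatched neighbours, match $v$ to the unmatched neighbour with the smallest rank; otherwise leave $v$ unmatched. *)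

theory Defs
  imports "HOL-Probability.Probability" "HOL-Library.Sublist"
begin

datatype 'v event = Arrival 'v | Deadline 'v

record 'v fom_input =
  vertices :: "'v set"
  edges :: "'v set set"
  events :: "'v event list"

text \<open>
  The graph is finite, undirected and simple. Each vertex has exactly one arrival and one
  deadline, and its deadline comes after its own arrival and after the arrivals of all its
  neighbours (\<^term>\<open>subseq [a, b] xs\<close> says that \<open>a\<close> occurs before \<open>b\<close> in \<open>xs\<close>). In the last
  clause both orientations of every edge are covered, since \<^term>\<open>{u, v} = {v, u}\<close>.
\<close>

definition fom_instance :: "'v fom_input \<Rightarrow> bool" where
  "fom_instance I \<longleftrightarrow>
     finite (vertices I) \<and>
     (\<forall>e\<in>edges I. e \<subseteq> vertices I \<and> card e = 2) \<and>
     distinct (events I) \<and>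
     set (events I) = Arrival ` vertices I \<union> Deadline ` vertices I \<and>
     (\<forall>v\<in>vertices I. subseq [Arrival v, Deadline v] (events I)) \<and>
     (\<forall>u v. {u, v} \<in> edges I \<longrightarrow> subseq [Arrival u, Deadline v] (events I))"

definition matching :: "'v set set \<Rightarrow> 'v set set \<Rightarrow> bool" where
  "matching E M \<longleftrightarrow> M \<subseteq> E \<and> pairwise disjnt M"

definition max_matching_size :: "'v set set \<Rightarrow> nat" where
  "max_matching_size E = Max (card ` {M. matching E M})"

text \<open>
  A randomized algorithm is given by the distribution \<open>P I\<close> of its random choices \<open>\<omega>\<close> on input
  \<open>I\<close> and the matching \<open>A I \<omega>\<close> it outputs. The adversary is oblivious: the input is chosen
  before \<open>\<omega>\<close>.
\<close>

definition competitive ::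
  "real \<Rightarrow> ('v fom_input \<Rightarrow> 'w measure) \<Rightarrow> ('v fom_input \<Rightarrow> 'w \<Rightarrow> 'v set set) \<Rightarrow> bool" where
  "competitive F P A \<longleftrightarrow>
     (\<forall>I. fom_instance I \<longrightarrow>
        (\<integral>\<omega>. real (card (A I \<omega>)) \<partial>P I) \<ge> F * real (max_matching_size (edges I)))"

text \<open>
  The ranks are independent and uniform on \<open>[0,1)\<close>. Drawing them all at the start gives the same
  process as drawing each on arrival, because a rank is read only at deadlines of neighbours of
  its vertex, which come after its arrival.
\<close>

definition rank_measure :: "'v fom_input \<Rightarrow> ('v \<Rightarrow> real) measure" where
  "rank_measure I = PiM (vertices I) (\<lambda>_. uniform_measure lborel {0..<1})"

text \<open>
  The state is the set \<open>M\<close> of edges matched so far. At the deadline of \<open>v\<close> all neighbours of \<open>v\<close>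
  in the whole graph have arrived, so no restriction to arrived vertices is needed. Ties between
  ranks, which have probability zero, are broken arbitrarily by \<^const>\<open>arg_min_on\<close>.
\<close>

fun ranking_step ::
  "'v set set \<Rightarrow> ('v \<Rightarrow> real) \<Rightarrow> 'v event \<Rightarrow> 'v set set \<Rightarrow> 'v set set" where
  "ranking_step E y (Arrival v) M = M"
| "ranking_step E y (Deadline v) M =
     (let N = {u. {u, v} \<in> E \<and> u \<notin> \<Union>M}
      in if v \<notin> \<Union>M \<and> N \<noteq> {} then insert {v, arg_min_on y N} M else M)"

definition ranking :: "'v fom_input \<Rightarrow> ('v \<Rightarrow> real) \<Rightarrow> 'v set set" where
  "ranking I y = fold (ranking_step (edges I) y) (events I) {}"

end

theory Submission imports Defs "HOL-Probability.Probability" begin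

text \<open>
  A matched pair shares its gain: when \<open>a\<close> picks the passive vertex \<open>p\<close> at its deadline, \<open>p\<close> gets
  \<open>pshare y\<^sub>p\<close> and \<open>a\<close> gets the rest. The active vertex further pays \<open>bonus y\<^sub>p\<close> to its victim, an
  unmatched neighbour that would be matched if \<open>a\<close> were deleted; it is unique because
  deleting one vertex changes the set of matched vertices along a single alternating path.
  It suffices that the two ends of every edge \<open>uv\<close> expect a total gain of \<open>0.5211\<close>, with all
  ranks but \<open>x = y\<^sub>u\<close> and \<open>y = y\<^sub>v\<close> fixed.

  Rescaled, the gain of the two ends is \<open>w x y\<close>. It falls below \<open>J = 93/200\<close> where one end
  is passive with a small rank and the other is unmatched. Suppose \<open>v\<close> is unmatched at \<open>(x, y)\<close>
  while \<open>u\<close> is unmatched at some \<open>(x, y')\<close> with \<open>y' < y\<close>. Then \<open>v\<close> is a victim, so it is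
  compensated at \<open>(x, y)\<close>. Hence the losses in the two directions are at most the measures of
  two subsets \<open>A\<close>, \<open>B\<close> of the triangle \<open>x + y < J\<close>. A point of \<open>A \<inter> B\<close> has no loss and a
  surplus of at least 1, so the total loss is at most the measure of \<open>A \<union> B\<close>, that is
  \<open>J\<^sup>2 / 2\<close>. Points where neither end is passive occur only above a threshold \<open>\<beta>\<close> in a column
  \<open>x\<close>, and their loss is outweighed by the points below \<open>\<beta>\<close>. This gives
  \<open>9/20 + (J - J\<^sup>2/2) / 5 = 0.5213\<dots>\<close>.
\<close>

subsection \<open>Uniform ranks\<close>

text \<open>Shares and bonuses stop growing at rank 1/2. Clamping below at 0 makes the bounds hold
  for all reals, so the gain estimates need no range assumption on ranks.\<close>

definition cap :: "real \<Rightarrow> real" where "cap t = max 0 (min t (1/2))"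

lemma cap_mono: "s \<le> t \<Longrightarrow> cap s \<le> cap t"
  by (auto simp: cap_def)

lemma cap_le: "cap t \<le> 1/2"
  by (auto simp: cap_def)

lemma cap_nonneg: "0 \<le> cap t"
  by (auto simp: cap_def)

abbreviation unif :: "real measure" where "unif \<equiv> uniform_measure lborel {0..<1}"

lemma prob_unif: "prob_space unif"
  by (rule prob_space_uniform_measure) auto

interpretation unif: prob_space unif
  by (rule prob_unif)

lemma unif_density: "unif = density lborel (\<lambda>x. ennreal (indicator {0..<1} x))"
  unfolding uniform_measure_def by (simp add: divide_ennreal_def ennreal_indicator)

lemma sets_unif [measurable_cong]: "sets unif = sets borel"
  by simp

lemma space_unif [simp]: "space unif = UNIV"
  by simp

lemma measure_unif:
  assumes "0 \<le> a" "a \<le> b" "b \<le> 1"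
  shows "measure unif {a<..<b} = b - a"
proof -
  have "emeasure unif {a<..<b} = emeasure lborel ({0..<1} \<inter> {a<..<b})"
    by (subst emeasure_uniform_measure) (auto simp: divide_ennreal_def)
  also have "{0..<1} \<inter> {a<..<b} = {a<..<b}" using assms by auto
  finally show ?thesis using assms by (simp add: measure_def)
qed

lemma measure_unif_Ioi:
  assumes "0 \<le> a" "a \<le> 1"
  shows "measure unif {a<..} = 1 - a"
proof -
  have "emeasure unif {a<..} = emeasure lborel ({0..<1} \<inter> {a<..})"
    by (subst emeasure_uniform_measure) (auto simp: divide_ennreal_def)
  also have "{0..<1} \<inter> {a<..} = {a<..<1}" using assms by auto
  finally show ?thesis using assms by (simp add: measure_def)
qed

lemma integral_unif_ident:
  assumes "0 \<le> a" "a < 1"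
  shows "(\<integral>y. y * indicator {0..a} y \<partial>unif) = a\<^sup>2 / 2"
proof -
  have "(\<integral>y. y * indicator {0..a} y \<partial>unif) = (\<integral>y. indicator {0..<1} y * (y * indicator {0..a} y) \<partial>lborel)"
    unfolding unif_density by (subst integral_density) auto
  also have "\<dots> = (\<integral>y. y ^ 1 * indicator {0..a} y \<partial>lborel)"
    by (rule Bochner_Integration.integral_cong) (use assms in \<open>auto simp: indicator_def\<close>)
  also have "\<dots> = a\<^sup>2 / 2"
    using assms by (subst integral_power) (auto simp: power2_eq_square)
  finally show ?thesis .
qed

lemma AE_unif_range: "AE y in unif. 0 < y \<and> y < 1"
proof -
  have "AE y in lborel. y \<noteq> (0::real)" by (rule AE_lborel_singleton)
  then show ?thesis
    unfolding unif_density by (subst AE_density) (auto simp: indicator_def split: if_splits)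
qed

lemma AE_unif_neq: "AE y in unif. y \<noteq> c"
proof -
  have "AE y in lborel. y \<noteq> c" by (rule AE_lborel_singleton)
  then show ?thesis unfolding unif_density by (subst AE_density) auto
qed

lemma AE_unif_finite:
  assumes "finite R"
  shows "AE y in unif. y \<notin> R"
proof -
  have "AE y in unif. \<forall>c\<in>R. y \<noteq> c"
    using assms AE_unif_neq by (subst AE_finite_all) auto
  then show ?thesis by (rule AE_mp) auto
qed

interpretation UU: pair_prob_space unif unif ..

text \<open>Fubini: the section at \<open>x\<close> has length \<open>c - x\<close> for
  \<open>0 < x\<close> and \<open>x \<le> c\<close>, and is empty for larger \<open>x\<close>. With
  \<open>c = J\<close> this area bounds the total loss.\<close>

lemma measure_triangle:
  assumes "0 \<le> c" "c < 1"
  shows "measure (unif \<Otimes>\<^sub>M unif) {(x, y). 0 < x \<and> 0 < y \<and> x + y < c} = c\<^sup>2 / 2"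
proof -
  let ?T = "{(x, y). 0 < x \<and> 0 < y \<and> x + y < c} :: (real \<times> real) set"
  have "?T = {p \<in> space (borel \<Otimes>\<^sub>M borel). 0 < fst p \<and> 0 < snd p \<and> fst p + snd p < c}"
    by (auto simp: space_pair_measure)
  also have "\<dots> \<in> sets (borel \<Otimes>\<^sub>M borel)" by measurable
  also have "sets (borel \<Otimes>\<^sub>M borel) = sets (unif \<Otimes>\<^sub>M unif)"
    by (rule sets_pair_measure_cong) auto
  finally have T [measurable]: "?T \<in> sets (unif \<Otimes>\<^sub>M unif)" .
  have "measure (unif \<Otimes>\<^sub>M unif) ?T = (\<integral>p. indicator ?T p \<partial>(unif \<Otimes>\<^sub>M unif))"
    by (simp add: space_pair_measure)
  also have "\<dots> = (\<integral>x. \<integral>y. indicator ?T (x, y) \<partial>unif \<partial>unif)"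
    by (subst UU.integral_fst'[symmetric]) (auto intro: UU.integrable_const_bound[where B = 1])
  also have "\<dots> = (\<integral>x. c * indicator {0..c} x - x * indicator {0..c} x \<partial>unif)"
  proof (rule integral_cong_AE)
    show "AE x in unif. (\<integral>y. indicator ?T (x, y) \<partial>unif) = c * indicator {0..c} x - x * indicator {0..c} x"
      using AE_unif_range
    proof eventually_elim
      fix x :: real assume x: "0 < x \<and> x < 1"
      have "(\<integral>y. indicator ?T (x, y) \<partial>unif) = (\<integral>y. indicator {0<..<c - x} y \<partial>unif)"
        by (rule Bochner_Integration.integral_cong) (use x in \<open>auto simp: indicator_def\<close>)
      also have "\<dots> = c * indicator {0..c} x - x * indicator {0..c} x"
      proof (cases "x \<le> c")
        case True
        then show ?thesis using measure_unif[of 0 "c - x"] x assms by simp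
      next
        case False
        then show ?thesis by simp
      qed
      finally show "(\<integral>y. indicator ?T (x, y) \<partial>unif) = c * indicator {0..c} x - x * indicator {0..c} x" .
    qed
  qed auto
  also have "\<dots> = (\<integral>x. c * indicator {0..c} x \<partial>unif) - (\<integral>x. x * indicator {0..c} x \<partial>unif)"
    by (rule Bochner_Integration.integral_diff)
      (rule unif.integrable_const_bound[where B = 1], use assms in \<open>auto simp: indicator_def\<close>)+
  also have "(\<integral>x. c * indicator {0..c} x \<partial>unif) = c * c"
  proof -
    have "(\<integral>x. c * indicator {0..c} x \<partial>unif) = (\<integral>x. c * indicator {0<..<c} x \<partial>unif)"
    proof (rule integral_cong_AE)
      show "AE x in unif. c * indicator {0..c} x = c * indicator {0<..<c} x"
        using AE_unif_neq[of 0] AE_unif_neq[of c] by eventually_elim (auto simp: indicator_def)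
    qed auto
    then show ?thesis using measure_unif[of 0 c] assms by simp
  qed
  finally show ?thesis using integral_unif_ident[OF assms] by (simp add: power2_eq_square)
qed

subsection \<open>Two uniform ranks\<close>

text \<open>
  Here \<open>w x y\<close> is five times the excess over \<open>9/20\<close> of the gain of the ends \<open>u\<close>, \<open>v\<close> of an edge at
  ranks \<open>x\<close>, \<open>y\<close>, where \<open>u\<close> has the earlier deadline. \<open>pu\<close>, \<open>pv\<close>: the end is matched
  passively; \<open>bu\<close>: \<open>u\<close> is passive and \<open>v\<close> unmatched; \<open>cu\<close>: \<open>v\<close> is passive and \<open>u\<close>
  unmatched; \<open>dd\<close>: neither end is passive, in which case \<open>u\<close> is active; \<open>th\<close>: the rank of the
  vertex picked by \<open>u\<close>, if any; \<open>R\<close>: the ranks of the other vertices; \<open>gen\<close>: the ranks are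
  generic.
\<close>

locale rank_square =
  fixes w th :: "real \<Rightarrow> real \<Rightarrow> real"
    and pu pv cu bu :: "real \<Rightarrow> real \<Rightarrow> bool"
    and R :: "real set" and K :: real
    and gen :: "real \<Rightarrow> real \<Rightarrow> bool" and dd :: "real \<Rightarrow> real \<Rightarrow> bool"
  assumes finR: "finite R"
    and gen_iff: "\<And>x y. gen x y \<longleftrightarrow> 0 < x \<and> x < 1 \<and> 0 < y \<and> y < 1 \<and> x \<notin> R \<and> y \<notin> R \<and> x \<noteq> y"
    and dd_iff: "\<And>x y. dd x y \<longleftrightarrow> gen x y \<and> \<not> pu x y \<and> \<not> pv x y"
    and w_meas: "(\<lambda>p. w (fst p) (snd p)) \<in> borel_measurable (borel \<Otimes>\<^sub>M borel)"
    and cu_meas: "Measurable.pred (borel \<Otimes>\<^sub>M borel) (\<lambda>p. cu (fst p) (snd p))"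
    and bu_meas: "Measurable.pred (borel \<Otimes>\<^sub>M borel) (\<lambda>p. bu (fst p) (snd p))"
    and dd_meas: "Measurable.pred (borel \<Otimes>\<^sub>M borel) (\<lambda>p. dd (fst p) (snd p))"
    and w_bound: "\<And>x y. \<bar>w x y\<bar> \<le> K"
    and cuD: "\<And>x y. cu x y \<Longrightarrow> gen x y \<and> pv x y \<and> \<not> pu x y"
    and buD: "\<And>x y. bu x y \<Longrightarrow> gen x y \<and> pu x y \<and> \<not> pv x y"
    and both: "\<And>x y. gen x y \<Longrightarrow> pu x y \<Longrightarrow> pv x y \<Longrightarrow> 9/4 + cap y \<le> w x y"
    and pu_rich: "\<And>x y. gen x y \<Longrightarrow> pu x y \<Longrightarrow> \<not> pv x y \<Longrightarrow> \<not> bu x y \<Longrightarrow> 7/4 \<le> w x y"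
    and bu_val: "\<And>x y. bu x y \<Longrightarrow> cap x \<le> w x y"
    and bu_bonus: "\<And>x y y'. bu x y \<Longrightarrow> cu x y' \<Longrightarrow> y' < y \<Longrightarrow> cap x + cap y' \<le> w x y"
    and pv_rich: "\<And>x y. gen x y \<Longrightarrow> \<not> pu x y \<Longrightarrow> pv x y \<Longrightarrow> \<not> cu x y \<Longrightarrow>
        11/4 + cap y - 2 * cap (th x y) \<le> w x y"
    and cu_val: "\<And>x y. cu x y \<Longrightarrow> cap y \<le> w x y"
    and cu_bonus: "\<And>x y x'. cu x y \<Longrightarrow> bu x' y \<Longrightarrow> x' < x \<Longrightarrow> cap y + cap x' \<le> w x y"
    and th: "\<And>x y. dd x y \<Longrightarrow> th x y < y"
    and dd_val: "\<And>x y. dd x y \<Longrightarrow> 1/2 - 2 * cap (th x y) \<le> w x y"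
    and dd_cu: "\<And>x y y'. dd x y \<Longrightarrow> cu x y' \<Longrightarrow> y' < y \<Longrightarrow> 1/2 - cap (th x y) + cap y' \<le> w x y"
    and dd_pv: "\<And>x y y'. dd x y \<Longrightarrow> gen x y' \<Longrightarrow> pv x y' \<Longrightarrow> \<not> pu x y' \<Longrightarrow> \<not> cu x y' \<Longrightarrow>
        y' < y \<Longrightarrow> y < th x y' \<Longrightarrow> 1/2 - 2 * cap (th x y) + cap y' \<le> w x y"
    and raise_y: "\<And>x y y'. gen x y \<Longrightarrow> gen x y' \<Longrightarrow> y < y' \<Longrightarrow> \<not> pv x y \<Longrightarrow>
        \<not> pv x y' \<and> (pu x y' \<longleftrightarrow> pu x y) \<and> th x y' = th x y"
    and raise_x: "\<And>x x' y. gen x y \<Longrightarrow> gen x' y \<Longrightarrow> x < x' \<Longrightarrow> \<not> pu x y \<Longrightarrow> \<not> pu x' y"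
    and locally_const: "\<And>x y. gen x y \<Longrightarrow> \<exists>e>0. \<forall>x' y'. \<bar>x' - x\<bar> < e \<longrightarrow> \<bar>y' - y\<bar> < e \<longrightarrow>
        (cu x' y' \<longleftrightarrow> cu x y) \<and> (bu x' y' \<longleftrightarrow> bu x y) \<and> (dd x' y' \<longleftrightarrow> dd x y)"
begin

text \<open>Columns that meet \<open>dd\<close> but not \<open>cu\<close> decide the value: the
  smallest bound obtained in \<open>column_no_loss\<close> is 1/2 - 49/1440 = 0.4659..., and 93/200
  lies just below it.\<close>

abbreviation J :: real where "J \<equiv> 93/200"

lemma measurable_UU: "f \<in> borel_measurable (borel \<Otimes>\<^sub>M borel) \<Longrightarrow> f \<in> borel_measurable (unif \<Otimes>\<^sub>M unif)"
  by (subst measurable_cong_sets[OF sets_pair_measure_cong refl]) auto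

text \<open>Quantifying over rational ranks only keeps these sets measurable. It loses nothing because
  \<open>bu\<close>, \<open>cu\<close> and \<open>dd\<close> are locally constant.\<close>

definition dcol :: "real \<Rightarrow> bool" where "dcol x \<longleftrightarrow> (\<exists>r\<in>\<rat>. dd x r)"

definition A :: "(real \<times> real) set" where
  "A = {p. 0 < fst p \<and> 0 < snd p \<and> fst p + snd p < J \<and> \<not> dcol (fst p) \<and>
      (\<forall>r\<in>\<rat>. snd p < r \<longrightarrow> \<not> cu (fst p) r)}"

definition B :: "(real \<times> real) set" where
  "B = {p. 0 < fst p \<and> 0 < snd p \<and> fst p + snd p < J \<and> (\<forall>r\<in>\<rat>. fst p < r \<longrightarrow> \<not> bu r (snd p))}"

text \<open>A generic point has a neighbourhood on which the three predicates are constant, and it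
  contains larger rationals. This links the rational quantifiers in \<open>dcol\<close>,
  \<open>A\<close> and \<open>B\<close> to actual points.\<close>

lemma near_rat:
  assumes "gen x y"
  obtains r where "r \<in> \<rat>" "y < r" "cu x r \<longleftrightarrow> cu x y" "dd x r \<longleftrightarrow> dd x y"
    and "\<exists>r\<in>\<rat>. x < r \<and> (bu r y \<longleftrightarrow> bu x y)"
proof -
  obtain e where e: "e > 0" "\<And>x' y'. \<bar>x' - x\<bar> < e \<Longrightarrow> \<bar>y' - y\<bar> < e \<Longrightarrow>
        (cu x' y' \<longleftrightarrow> cu x y) \<and> (bu x' y' \<longleftrightarrow> bu x y) \<and> (dd x' y' \<longleftrightarrow> dd x y)"
    using locally_const[OF assms] by blast
  obtain r where r: "r \<in> \<rat>" "y < r" "r < y + e" using Rats_dense_in_real[of y "y + e"] e(1) by auto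
  obtain q where q: "q \<in> \<rat>" "x < q" "q < x + e" using Rats_dense_in_real[of x "x + e"] e(1) by auto
  have "cu x r \<longleftrightarrow> cu x y" "dd x r \<longleftrightarrow> dd x y" using e(2)[of x r] e(1) r by auto
  moreover have "bu q y \<longleftrightarrow> bu x y" using e(2)[of q y] e(1) q by auto
  ultimately show thesis using that r q by blast
qed

lemma cu_sec [measurable]: "Measurable.pred borel (\<lambda>x. cu x r)" "Measurable.pred borel (\<lambda>y. cu r y)"
  using measurable_compose[OF measurable_Pair2'[of r borel borel] cu_meas]
    measurable_compose[OF measurable_Pair1'[of r borel borel] cu_meas] by auto

lemma bu_sec [measurable]: "Measurable.pred borel (\<lambda>y. bu r y)"
  using measurable_compose[OF measurable_Pair1'[of r borel borel] bu_meas] by auto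

lemma dd_sec [measurable]: "Measurable.pred borel (\<lambda>x. dd x r)"
  using measurable_compose[OF measurable_Pair2'[of r borel borel] dd_meas] by auto

lemma A_meas: "A \<in> sets (unif \<Otimes>\<^sub>M unif)"
proof -
  have [measurable]: "Measurable.pred borel dcol"
  proof -
    have "dcol = (\<lambda>x. \<exists>r\<in>\<rat>. dd x r)" by (auto simp: dcol_def fun_eq_iff)
    then show ?thesis using countable_rat by (simp only:) measurable
  qed
  have "A = {p \<in> space (borel \<Otimes>\<^sub>M borel). 0 < fst p \<and> 0 < snd p \<and> fst p + snd p < J \<and> \<not> dcol (fst p) \<and>
      (\<forall>r\<in>\<rat>. snd p < r \<longrightarrow> \<not> cu (fst p) r)}"
    by (auto simp: A_def space_pair_measure)
  also have "\<dots> \<in> sets (borel \<Otimes>\<^sub>M borel)"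
    using countable_rat by measurable
  also have "sets (borel \<Otimes>\<^sub>M borel) = sets (unif \<Otimes>\<^sub>M unif)"
    by (rule sets_pair_measure_cong) auto
  finally show ?thesis .
qed

lemma B_meas: "B \<in> sets (unif \<Otimes>\<^sub>M unif)"
proof -
  have "B = {p \<in> space (borel \<Otimes>\<^sub>M borel). 0 < fst p \<and> 0 < snd p \<and> fst p + snd p < J \<and>
      (\<forall>r\<in>\<rat>. fst p < r \<longrightarrow> \<not> bu r (snd p))}"
    by (auto simp: B_def space_pair_measure)
  also have "\<dots> \<in> sets (borel \<Otimes>\<^sub>M borel)"
    using countable_rat by measurable
  also have "sets (borel \<Otimes>\<^sub>M borel) = sets (unif \<Otimes>\<^sub>M unif)"
    by (rule sets_pair_measure_cong) auto
  finally show ?thesis .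
qed

lemma dcol_iff:
  assumes "dd x y"
  shows "dcol x"
  using near_rat[of x y] assms unfolding dcol_def dd_iff by metis

section \<open>Sections of the loss regions and the bound at a single point\<close>

definition secA where "secA x = measure unif {y. (x, y) \<in> A}"
definition secB where "secB y = measure unif {x. (x, y) \<in> B}"

lemma sets_secA: "{y. (x, y) \<in> A} \<in> sets unif"
  using sets_Pair1[OF A_meas, of x] by (simp add: vimage_def)

lemma sets_secB: "{x. (x, y) \<in> B} \<in> sets unif"
  using sets_Pair2[OF B_meas, of y] by (simp add: vimage_def)

lemma secA_nonneg: "0 \<le> secA x" and secB_nonneg: "0 \<le> secB y"
  by (simp_all add: secA_def secB_def)

text \<open>Only a shortfall \<open>w x y < J\<close> has to be charged. Every \<open>r\<close> with
  \<open>cu x r\<close> lies below \<open>y\<close>, so \<open>bu_bonus\<close> forces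
  \<open>r \<le> w x y - x\<close>. Hence the interval from \<open>w x y - x\<close> to
  \<open>J - x\<close>, whose length is the shortfall, lies in the section of \<open>A\<close> at
  \<open>x\<close>.\<close>

lemma bu_ge:
  assumes bu: "bu x y"
  shows "J - secA x \<le> w x y"
proof (cases "J \<le> w x y")
  case True
  then show ?thesis using secA_nonneg[of x] by simp
next
  case False
  have g: "gen x y" "pu x y" "\<not> pv x y" using buD[OF bu] by auto
  then have x: "0 < x" "x < 1" by (auto simp: gen_iff)
  have xw: "x \<le> w x y" "x < J" using bu_val[OF bu] False by (auto simp: cap_def split: if_splits)
  \<comment> \<open>By \<open>raise_y\<close>, all ranks of \<open>v\<close> in this column at which
    \<open>v\<close> is not passive agree on whether \<open>u\<close> is passive, so a
    \<open>bu\<close> and a \<open>dd\<close> point cannot share a column.\<close>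
  have nd: "\<not> dcol x"
  proof
    assume "dcol x"
    then obtain r where r: "dd x r" by (auto simp: dcol_def)
    then have *: "gen x r" "\<not> pu x r" "\<not> pv x r" by (auto simp: dd_iff)
    show False
      using raise_y[OF g(1) *(1)] raise_y[OF *(1) g(1)] g * by (cases y r rule: linorder_cases) auto
  qed
  have cu_le: "r \<le> w x y - x" if "cu x r" for r
  proof -
    have *: "gen x r" "pv x r" "\<not> pu x r" using cuD[OF that] by auto
    have "r < y" using raise_y[OF g(1) *(1)] g * by (cases y r rule: linorder_cases) auto
    then have "cap x + cap r \<le> w x y" by (rule bu_bonus[OF bu that])
    then show ?thesis using False xw x by (auto simp: cap_def split: if_splits)
  qed
  have "{w x y - x<..<J - x} \<subseteq> {y. (x, y) \<in> A}"
    using cu_le x xw nd by (fastforce simp: A_def)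
  then have "measure unif {w x y - x<..<J - x} \<le> secA x"
    unfolding secA_def by (intro unif.finite_measure_mono sets_secA)
  moreover have "measure unif {w x y - x<..<J - x} = J - w x y"
    using measure_unif[of "w x y - x" "J - x"] xw x False by simp
  ultimately show ?thesis by simp
qed

text \<open>The argument of \<open>bu_ge\<close> along the row \<open>y\<close>:
  \<open>raise_x\<close> puts every \<open>r\<close> with \<open>bu r y\<close> below
  \<open>x\<close>, \<open>cu_bonus\<close> bounds it by \<open>w x y - y\<close>, and the free
  interval lies in the section of \<open>B\<close>.\<close>

lemma cu_ge:
  assumes cu: "cu x y"
  shows "J - secB y \<le> w x y"
proof (cases "J \<le> w x y")
  case True
  then show ?thesis using secB_nonneg[of y] by simp
next
  case False
  have g: "gen x y" "pv x y" "\<not> pu x y" using cuD[OF cu] by auto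
  then have y: "0 < y" "y < 1" by (auto simp: gen_iff)
  have yw: "y \<le> w x y" "y < J" using cu_val[OF cu] False by (auto simp: cap_def split: if_splits)
  have bu_le: "r \<le> w x y - y" if "bu r y" for r
  proof -
    have *: "gen r y" "pu r y" "\<not> pv r y" using buD[OF that] by auto
    have "r < x" using raise_x[OF g(1) *(1)] g * by (cases x r rule: linorder_cases) auto
    then have "cap y + cap r \<le> w x y" by (rule cu_bonus[OF cu that])
    then show ?thesis using False yw y by (auto simp: cap_def split: if_splits)
  qed
  have "{w x y - y<..<J - y} \<subseteq> {x. (x, y) \<in> B}"
    using bu_le y yw by (fastforce simp: B_def)
  then have "measure unif {w x y - y<..<J - y} \<le> secB y"
    unfolding secB_def by (intro unif.finite_measure_mono sets_secB)
  moreover have "measure unif {w x y - y<..<J - y} = J - w x y"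
    using measure_unif[of "w x y - y" "J - y"] yw y False by simp
  ultimately show ?thesis by simp
qed

lemma rich:
  assumes "gen x y" "pu x y \<or> pv x y" "\<not> bu x y" "\<not> cu x y"
  shows "7/4 \<le> w x y"
  using both[of x y] pu_rich[of x y] pv_rich[of x y] assms cap_le[of "th x y"]
  by (cases "pu x y"; cases "pv x y") (auto simp: cap_def gen_iff split: if_splits)

lemma not_A_if_cu: "cu x y \<Longrightarrow> (x, y) \<notin> A"
  using near_rat[of x y] cuD[of x y] unfolding A_def by force

lemma not_B_if_bu: "bu x y \<Longrightarrow> (x, y) \<notin> B"
  using near_rat[of x y] buD[of x y] unfolding B_def by force

text \<open>A generic point of \<open>A\<close> is not \<open>cu\<close> and one of \<open>B\<close>
  is not \<open>bu\<close>. On \<open>A \<inter> B\<close> both ends are therefore matched, and 7/4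
  exceeds \<open>J\<close> by more than 1; this surplus later cancels the double count of the
  overlap.\<close>

lemma pointwise:
  assumes "gen x y" "\<not> dcol x"
  shows "J - secA x - secB y + indicator (A \<inter> B) (x, y) \<le> w x y"
proof -
  have nd: "pu x y \<or> pv x y" using assms dcol_iff[of x y] by (auto simp: dd_iff)
  consider "bu x y" | "cu x y" | "\<not> bu x y" "\<not> cu x y" by blast
  then show ?thesis
  proof cases
    case 1
    then show ?thesis using bu_ge[OF 1] not_B_if_bu[OF 1] secB_nonneg[of y] by simp
  next
    case 2
    then show ?thesis using cu_ge[OF 2] not_A_if_cu[OF 2] secA_nonneg[of x] by simp
  next
    case 3
    then show ?thesis
      using rich[OF assms(1) nd 3] secA_nonneg[of x] secB_nonneg[of y]
      by (simp add: indicator_def)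
  qed
qed

section \<open>Integrals along a single column\<close>

lemma AE_gen:
  assumes "0 < x" "x < 1" "x \<notin> R"
  shows "AE y in unif. gen x y"
  using AE_unif_range AE_unif_neq[of x] AE_unif_finite[OF finR]
  by eventually_elim (use assms in \<open>auto simp: gen_iff\<close>)

text \<open>By \<open>raise_y\<close> the generic ranks of \<open>v\<close> at which
  \<open>v\<close> is not passive are closed upwards, and \<open>pu\<close> and \<open>th\<close>
  are constant on them; one of them is \<open>dd\<close>, so all are. \<beta> is their infimum, and
  \<theta> is below each of them.\<close>

lemma dcol_structure:
  assumes "dcol x"
  obtains \<beta> \<theta> where "0 \<le> \<beta>" "\<beta> < 1" "\<theta> \<le> \<beta>"
    "\<And>y. gen x y \<Longrightarrow> y < \<beta> \<Longrightarrow> pv x y" "\<And>y. gen x y \<Longrightarrow> \<beta> < y \<Longrightarrow> dd x y \<and> th x y = \<theta>"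
proof -
  obtain y0 where y0: "dd x y0" using assms by (auto simp: dcol_def)
  define S where "S = {y. gen x y \<and> \<not> pv x y}"
  have y0S: "y0 \<in> S" using y0 by (auto simp: S_def dd_iff)
  have S01: "0 < y \<and> y < 1" if "y \<in> S" for y using that by (auto simp: S_def gen_iff)
  have S: "dd x y \<and> th x y = th x y0" if "y \<in> S" for y
  proof -
    have y: "gen x y" "\<not> pv x y" using that by (auto simp: S_def)
    have y0': "gen x y0" "\<not> pu x y0" "\<not> pv x y0" using y0 by (auto simp: dd_iff)
    have "(pu x y \<longleftrightarrow> pu x y0) \<and> th x y = th x y0"
      using raise_y[OF y(1) y0'(1)] raise_y[OF y0'(1) y(1)] y y0' by (cases y y0 rule: linorder_cases) auto
    then show ?thesis using y y0' by (auto simp: dd_iff)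
  qed
  have bdd: "bdd_below S" using S01 by (intro bdd_belowI[of _ 0]) (auto intro: less_imp_le)
  define \<beta> where "\<beta> = Inf S"
  show thesis
  proof (rule that[of \<beta> "th x y0"])
    show "0 \<le> \<beta>" unfolding \<beta>_def using y0S S01 by (intro cInf_greatest) (auto intro: less_imp_le)
    have "\<beta> \<le> y0" unfolding \<beta>_def by (rule cInf_lower[OF y0S bdd])
    then show "\<beta> < 1" using S01[OF y0S] by simp
    show "th x y0 \<le> \<beta>" unfolding \<beta>_def
    proof (rule cInf_greatest)
      fix y assume "y \<in> S"
      then show "th x y0 \<le> y" using S[of y] th[of x y] by auto
    qed (use y0S in auto)
    show "pv x y" if "gen x y" "y < \<beta>" for y
      using that cInf_lower[OF _ bdd, of y] unfolding \<beta>_def by (force simp: S_def)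
    show "dd x y \<and> th x y = th x y0" if "gen x y" "\<beta> < y" for y
    proof -
      have "\<exists>s\<in>S. s < y"
        using cInf_lessD[of S y] that y0S unfolding \<beta>_def by blast
      then obtain s where s: "s \<in> S" "s < y" by blast
      then have "\<not> pv x y" using raise_y[of x s y] that by (auto simp: S_def)
      then show ?thesis using S[of y] that by (auto simp: S_def)
    qed
  qed
qed

lemma w_sec [measurable]: "(\<lambda>y. w x y) \<in> borel_measurable borel"
  using measurable_compose[OF measurable_Pair1'[of x borel borel] w_meas] by auto

lemma integrable_w: "integrable unif (\<lambda>y. w x y)"
  by (rule unif.integrable_const_bound[where B = K]) (use w_bound in auto)

lemma integral_ind: "0 \<le> a \<Longrightarrow> a \<le> b \<Longrightarrow> b \<le> 1 \<Longrightarrow> (\<integral>y. k * indicator {a<..<b} y \<partial>unif) = k * (b - a)"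
  using measure_unif[of a b] by simp

lemma integral_ind_Ioi: "0 \<le> a \<Longrightarrow> a \<le> 1 \<Longrightarrow> (\<integral>y. k * indicator {a<..} y \<partial>unif) = k * (1 - a)"
  using measure_unif_Ioi[of a] by simp

lemma integrable_ind:
  assumes "S \<in> sets borel"
  shows "integrable unif (\<lambda>y. k * indicator S y :: real)"
proof -
  have "integrable unif (indicator S :: real \<Rightarrow> real)"
    by (rule unif.integrable_const_bound[where B = 1]) (use assms in auto)
  then show ?thesis by simp
qed

lemma integrable_ident_ind: "integrable unif (\<lambda>y. y * indicator {0..a} y)"
  by (rule unif.integrable_const_bound[where B = "\<bar>a\<bar>"]) (auto simp: indicator_def)

text \<open>The share paid away by \<open>u\<close> above \<open>\<beta>\<close> is made up for by the rows below \<open>\<beta>\<close>, where both ends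
  are matched: either the pick of \<open>u\<close> has a small rank \<open>th\<close> there, or \<open>v\<close> is compensated above
  \<open>\<beta>\<close> for ranks up to \<open>th\<close>.\<close>

lemma column_no_loss:
  assumes x: "0 < x" "x < 1" "x \<notin> R" and dc: "dcol x" and nocu: "\<And>y. \<not> cu x y"
  shows "J \<le> (\<integral>y. w x y \<partial>unif)"
proof -
  obtain \<beta> \<theta> where b: "0 \<le> \<beta>" "\<beta> < 1" "\<theta> \<le> \<beta>"
    and lo: "\<And>y. gen x y \<Longrightarrow> y < \<beta> \<Longrightarrow> pv x y" and hi: "\<And>y. gen x y \<Longrightarrow> \<beta> < y \<Longrightarrow> dd x y \<and> th x y = \<theta>"
    by (rule dcol_structure[OF dc]) blast
  have hi_val: "1/2 - 2 * cap \<theta> \<le> w x y" if "gen x y" "\<beta> < y" for y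
    using dd_val[of x y] hi[OF that] by auto
  show ?thesis
  proof (cases "\<beta> \<le> 1/2")
    case False
    \<comment> \<open>For a large \<beta> the worst values suffice: 7/4 below \<beta>, and 1/2 - 2 *
      (1/2) above it.\<close>
    let ?f = "\<lambda>y. 7/4 * indicator {0<..<\<beta>} y + (- 1/2) * indicator {\<beta><..} y :: real"
    have "(\<integral>y. ?f y \<partial>unif) \<le> (\<integral>y. w x y \<partial>unif)"
    proof (rule integral_mono_AE[OF _ integrable_w])
      show "integrable unif ?f" by (intro Bochner_Integration.integrable_add integrable_ind) auto
      show "AE y in unif. ?f y \<le> w x y"
        using AE_gen[OF x] AE_unif_neq[of \<beta>]
      proof eventually_elim
        fix y assume y: "gen x y" "y \<noteq> \<beta>"
        show "?f y \<le> w x y"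
        proof (cases "y < \<beta>")
          case True
          then have "7/4 \<le> w x y" using rich[OF y(1)] lo[OF y(1)] nocu buD by blast
          then show ?thesis using True by (auto simp: indicator_def)
        next
          case False
          then show ?thesis using hi_val[OF y(1)] y(2) cap_le[of \<theta>] by simp
        qed
      qed
    qed
    also have "(\<integral>y. ?f y \<partial>unif) = 7/4 * \<beta> - 1/2 * (1 - \<beta>)"
    proof -
      have "(\<integral>y. 7/4 * indicator {0<..<\<beta>} y \<partial>unif) = 7/4 * (\<beta> - 0)"
        by (rule integral_ind) (use b in auto)
      moreover have "(\<integral>y. (- 1/2) * indicator {\<beta><..} y \<partial>unif) = (- 1/2) * (1 - \<beta>)"
        by (rule integral_ind_Ioi) (use b in auto)
      ultimately show ?thesis
        by (subst Bochner_Integration.integral_add, (intro integrable_ind; simp)+) simp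
    qed
    finally have int: "7/4 * \<beta> - 1/2 * (1 - \<beta>) \<le> (\<integral>y. w x y \<partial>unif)" .
    have "J \<le> 7/4 * \<beta> - 1/2 * (1 - \<beta>)" using False by (simp add: field_simps)
    then show ?thesis using int by (rule order_trans)
  next
    case True
    \<comment> \<open>The choice satisfies \<open>\<kappa> = 2 * (\<beta> - \<kappa>)\<close>, so
      that \<sigma> cancels between \<open>- 2 * \<sigma> * (\<beta> - \<kappa>)\<close>, lost in
      the rows between \<kappa> and \<beta>, and \<open>\<kappa> * \<sigma>\<close>, gained above
      \<beta>.\<close>
    define \<kappa> where "\<kappa> = 2/3 * \<beta>"
    \<comment> \<open>Capped ranks picked by \<open>u\<close> in the rows between \<kappa> and
      \<beta> where \<open>u\<close> is active. Inserting 0 keeps the set nonempty and its supremum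
      \<sigma> nonnegative when there is no such row.\<close>
    define S where "S = insert 0 {cap (th x y) | y. \<kappa> < y \<and> y < \<beta> \<and> gen x y \<and> \<not> pu x y \<and> pv x y}"
    define \<sigma> where "\<sigma> = Sup S"
    define \<tau> where "\<tau> = max \<beta> \<sigma>"
    \<comment> \<open>Lower bound for \<open>w x y - y\<close> between \<kappa> and \<beta>: 9/4 if
      both ends are passive, \<open>11/4 - 2 * \<sigma>\<close> if \<open>u\<close> is
      active.\<close>
    define m where "m = min (9/4) (11/4 - 2 * \<sigma>)"
    have \<kappa>: "0 \<le> \<kappa>" "\<kappa> \<le> \<beta>" using b by (auto simp: \<kappa>_def)
    have bdd: "bdd_above S" using cap_le by (intro bdd_aboveI[of _ "1/2"]) (auto simp: S_def)
    have ne: "S \<noteq> {}" by (simp add: S_def)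
    have "\<sigma> \<le> 1/2"
      unfolding \<sigma>_def by (rule cSup_least[OF ne]) (use cap_le in \<open>auto simp: S_def\<close>)
    moreover have "0 \<le> \<sigma>" unfolding \<sigma>_def by (rule cSup_upper[OF _ bdd]) (simp add: S_def)
    ultimately have \<sigma>: "\<sigma> \<le> 1/2" "0 \<le> \<sigma>" by auto
    have \<tau>: "\<beta> \<le> \<tau>" "\<sigma> \<le> \<tau>" "\<tau> \<le> 1/2" using True \<sigma> by (auto simp: \<tau>_def)
    let ?f = "\<lambda>y. y * indicator {0..\<beta>} y + (7/4 * indicator {0<..<\<kappa>} y + (m * indicator {\<kappa><..<\<beta>} y +
       ((1/2 - 2 * \<beta>) * indicator {\<beta><..} y + \<kappa> * indicator {\<beta><..<\<tau>} y))) :: real"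
    have "(\<integral>y. ?f y \<partial>unif) \<le> (\<integral>y. w x y \<partial>unif)"
    proof (rule integral_mono_AE[OF _ integrable_w])
      show "integrable unif ?f"
        by (intro Bochner_Integration.integrable_add integrable_ind integrable_ident_ind) auto
      show "AE y in unif. ?f y \<le> w x y"
        using AE_gen[OF x] AE_unif_neq[of \<beta>] AE_unif_neq[of \<kappa>] AE_unif_neq[of \<tau>]
      proof eventually_elim
        fix y assume y: "gen x y" "y \<noteq> \<beta>" "y \<noteq> \<kappa>" "y \<noteq> \<tau>"
        have y0: "0 < y" "y < 1" using y(1) by (auto simp: gen_iff)
        consider "y < \<kappa>" | "\<kappa> < y" "y < \<beta>" | "\<beta> < y" using y by linarith
        then show "?f y \<le> w x y"
        proof cases
          case 1
          then have "y + 7/4 \<le> w x y"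
            using both[OF y(1)] pv_rich[OF y(1)] lo[OF y(1)] nocu \<kappa> True cap_le[of "th x y"]
            by (cases "pu x y") (auto simp: cap_def)
          then show ?thesis using 1 \<kappa> y0 by simp
        next
          case 2
          have cy: "cap y = y" using 2 True y0 by (simp add: cap_def)
          have "y + m \<le> w x y"
          proof (cases "pu x y")
            case True
            then show ?thesis using both[OF y(1)] lo[OF y(1)] 2 cy by (simp add: m_def)
          next
            case npu: False
            have "cap (th x y) \<le> \<sigma>" unfolding \<sigma>_def
              by (rule cSup_upper[OF _ bdd]) (use npu lo[OF y(1)] 2 y(1) in \<open>auto simp: S_def\<close>)
            then show ?thesis using pv_rich[OF y(1) npu] lo[OF y(1)] 2 cy nocu by (auto simp: m_def)
          qed
          then show ?thesis using 2 \<kappa> y0 by simp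
        next
          case 3
          have ct: "cap \<theta> \<le> \<beta>" using b by (simp add: cap_def)
          have "1/2 - 2 * \<beta> + \<kappa> \<le> w x y" if "y < \<tau>"
          proof -
            \<comment> \<open>Below \<sigma> some row \<open>y'\<close> between \<kappa> and \<beta>
              has a pick of rank above \<open>y\<close>; there \<open>dd_pv\<close> adds
              \<open>y'\<close>, which exceeds \<kappa>.\<close>
            have "y < \<sigma>" using that 3 by (simp add: \<tau>_def)
            then obtain z where "z \<in> S" "y < z" unfolding \<sigma>_def using less_cSup_iff[OF ne bdd] by auto
            then obtain y' where y': "y < cap (th x y')" "\<kappa> < y'" "y' < \<beta>" "gen x y'" "\<not> pu x y'" "pv x y'"
              using y0 by (auto simp: S_def)
            have "cap y' = y'" using y' True \<kappa> by (simp add: cap_def)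
            moreover have "y < th x y'" using y'(1) y0 by (simp add: cap_def)
            ultimately show ?thesis
              using dd_pv[of x y y'] hi[OF y(1) 3] y' nocu 3 ct by auto
          qed
          then show ?thesis using hi_val[OF y(1) 3] 3 \<kappa> y0 ct by (auto simp: indicator_def)
        qed
      qed
    qed
    also have "(\<integral>y. ?f y \<partial>unif) = \<beta>\<^sup>2 / 2 + (7/4 * \<kappa> + (m * (\<beta> - \<kappa>) + ((1/2 - 2 * \<beta>) * (1 - \<beta>) + \<kappa> * (\<tau> - \<beta>))))"
    proof -
      have "(\<integral>y. y * indicator {0..\<beta>} y \<partial>unif) = \<beta>\<^sup>2 / 2"
        by (rule integral_unif_ident) (use b in auto)
      moreover have "(\<integral>y. 7/4 * indicator {0<..<\<kappa>} y \<partial>unif) = 7/4 * (\<kappa> - 0)"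
        by (rule integral_ind) (use b \<kappa> in auto)
      moreover have "(\<integral>y. m * indicator {\<kappa><..<\<beta>} y \<partial>unif) = m * (\<beta> - \<kappa>)"
        by (rule integral_ind) (use b \<kappa> in auto)
      moreover have "(\<integral>y. (1/2 - 2 * \<beta>) * indicator {\<beta><..} y \<partial>unif) = (1/2 - 2 * \<beta>) * (1 - \<beta>)"
        by (rule integral_ind_Ioi) (use b in auto)
      moreover have "(\<integral>y. \<kappa> * indicator {\<beta><..<\<tau>} y \<partial>unif) = \<kappa> * (\<tau> - \<beta>)"
        by (rule integral_ind) (use b \<tau> in auto)
      ultimately show ?thesis
      by (subst Bochner_Integration.integral_add, (intro Bochner_Integration.integrable_add integrable_ind integrable_ident_ind; simp)+)+
        (simp only: diff_0_right)
    qed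
    also have "J \<le> \<dots>"
    proof (cases "\<sigma> \<le> 1/4")
      case True
      then have m: "m = 9/4" by (simp add: m_def)
      have "0 \<le> \<kappa> * (\<tau> - \<beta>)" using \<kappa> \<tau> by simp
      \<comment> \<open>Completing the square: 7/60 minimises the quadratic in \<beta>, and 7/7200
        is the remaining slack over \<open>J\<close>.\<close>
      moreover have "0 \<le> 5/2 * (\<beta> - 7/60)\<^sup>2" by simp
      moreover have "\<beta>\<^sup>2 / 2 + (7/4 * \<kappa> + (m * (\<beta> - \<kappa>) + ((1/2 - 2 * \<beta>) * (1 - \<beta>) + \<kappa> * (\<tau> - \<beta>))))
          = J + 7/7200 + 5/2 * (\<beta> - 7/60)\<^sup>2 + \<kappa> * (\<tau> - \<beta>)"
        unfolding m \<kappa>_def by (simp add: power2_eq_square field_simps)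
      ultimately show ?thesis by linarith
    next
      case False
      then have m: "m = 11/4 - 2 * \<sigma>" by (simp add: m_def)
      have "0 \<le> \<kappa> * (\<tau> - \<sigma>)" using \<kappa> \<tau> by simp
      \<comment> \<open>Writing \<open>\<tau> - \<beta>\<close> as
        \<open>(\<tau> - \<sigma>) + (\<sigma> - \<beta>)\<close> removes \<sigma> from the rest.
        The quadratic left over has its minimum 1/2 - 25/1056 at 5/44, which is above
        \<open>J\<close>.\<close>
      moreover have "0 \<le> 11/6 * (\<beta> - 5/44)\<^sup>2" by simp
      moreover have "\<beta>\<^sup>2 / 2 + (7/4 * \<kappa> + (m * (\<beta> - \<kappa>) + ((1/2 - 2 * \<beta>) * (1 - \<beta>) + \<kappa> * (\<tau> - \<beta>))))
          = J + (7/200 - 25/1056) + 11/6 * (\<beta> - 5/44)\<^sup>2 + \<kappa> * (\<tau> - \<sigma>)"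
        unfolding m \<kappa>_def by (simp add: power2_eq_square field_simps)
      ultimately show ?thesis by linarith
    qed
    finally show ?thesis by simp
  qed
qed

lemma secB_eq: "secB y = (\<integral>x. indicator B (x, y) \<partial>unif)"
proof -
  have "(\<integral>x. indicator B (x, y) \<partial>unif) = (\<integral>x. indicator {x. (x, y) \<in> B} x \<partial>unif :: real)"
    by (rule Bochner_Integration.integral_cong) (auto simp: indicator_def)
  then show ?thesis by (simp add: secB_def)
qed

lemma secA_eq: "secA x = (\<integral>y. indicator A (x, y) \<partial>unif)"
proof -
  have "(\<integral>y. indicator A (x, y) \<partial>unif) = (\<integral>y. indicator {y. (x, y) \<in> A} y \<partial>unif :: real)"
    by (rule Bochner_Integration.integral_cong) (auto simp: indicator_def)
  then show ?thesis by (simp add: secA_def)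
qed

lemma integrable_indP: "S \<in> sets (unif \<Otimes>\<^sub>M unif) \<Longrightarrow> integrable (unif \<Otimes>\<^sub>M unif) (indicator S :: _ \<Rightarrow> real)"
  by (rule UU.integrable_const_bound[where B = 1]) auto

lemma integrable_secA: "integrable unif secA"
  using UU.integrable_fst'[OF integrable_indP[OF A_meas]] by (simp add: secA_eq[abs_def])

lemma integrable_secB: "integrable unif secB"
  using UU.integrable_snd[of "\<lambda>x y. indicator B (x, y) :: real"] integrable_indP[OF B_meas]
  by (simp add: secB_eq[abs_def])

text \<open>Let \<open>c\<close> be the supremum of the \<open>cu\<close> heights. Below
  \<open>c\<close> only the loss charged to \<open>B\<close> occurs. Between \<open>c\<close> and
  \<beta> both ends are matched, with a surplus of 5/4 over \<open>J\<close>. Above \<beta> the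
  compensation limits the shortfall to \<open>\<beta> - c\<close>, on a length
  \<open>1 - \<beta>\<close>, which that surplus covers.\<close>

lemma column_loss:
  assumes x: "0 < x" "x < 1" "x \<notin> R" and dc: "dcol x" and cu: "cu x y1"
  shows "J - (\<integral>y. secB y \<partial>unif) \<le> (\<integral>y. w x y \<partial>unif)"
proof -
  obtain \<beta> \<theta> where b: "0 \<le> \<beta>" "\<beta> < 1" "\<theta> \<le> \<beta>"
    and lo: "\<And>y. gen x y \<Longrightarrow> y < \<beta> \<Longrightarrow> pv x y" and hi: "\<And>y. gen x y \<Longrightarrow> \<beta> < y \<Longrightarrow> dd x y \<and> th x y = \<theta>"
    by (rule dcol_structure[OF dc]) blast
  define S where "S = {y. cu x y}"
  define c where "c = Sup S"
  have S: "0 < y \<and> y \<le> \<beta>" if "y \<in> S" for y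
    using that cuD[of x y] hi[of y] by (auto simp: S_def gen_iff dd_iff not_less[symmetric])
  have bdd: "bdd_above S" using S by (intro bdd_aboveI[of _ \<beta>]) auto
  have y1: "y1 \<in> S" using cu by (simp add: S_def)
  have c: "0 \<le> c" "c \<le> \<beta>"
    unfolding c_def using S[OF y1] cSup_upper[OF y1 bdd] S y1 by (linarith, intro cSup_least) auto
  let ?f = "\<lambda>y. (J - secB y) + (5/4 * indicator {c<..<\<beta>} y + (c - \<beta>) * indicator {\<beta><..} y)"
  have "(\<integral>y. ?f y \<partial>unif) \<le> (\<integral>y. w x y \<partial>unif)"
  proof (rule integral_mono_AE[OF _ integrable_w])
    show "integrable unif ?f"
      by (intro Bochner_Integration.integrable_add Bochner_Integration.integrable_diff integrable_secB integrable_ind) auto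
    show "AE y in unif. ?f y \<le> w x y"
      using AE_gen[OF x] AE_unif_neq[of \<beta>] AE_unif_neq[of c]
    proof eventually_elim
      fix y assume y: "gen x y" "y \<noteq> \<beta>" "y \<noteq> c"
      consider "y < c" | "c < y" "y < \<beta>" | "\<beta> < y" using y by linarith
      then show "?f y \<le> w x y"
      proof cases
        case 1
        have "J - secB y \<le> w x y"
        proof (cases "cu x y")
          case True
          then show ?thesis by (rule cu_ge)
        next
          case False
          then have "7/4 \<le> w x y" using rich[OF y(1)] lo[OF y(1)] 1 c buD by force
          then show ?thesis using secB_nonneg[of y] by simp
        qed
        then show ?thesis using 1 c by simp
      next
        case 2
        have "\<not> cu x y" using cSup_upper[OF _ bdd, of y] 2 by (auto simp: S_def c_def)
        then have "7/4 \<le> w x y" using rich[OF y(1)] lo[OF y(1)] 2 buD by force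
        then show ?thesis using 2 secB_nonneg[of y] by simp
      next
        case 3
        \<comment> \<open>The supremum \<open>c\<close> need not be attained; a violation would
          leave room for a \<open>cu\<close> height \<open>y'\<close> close enough to
          \<open>c\<close> to contradict \<open>dd_cu\<close>.\<close>
        have "1/2 - (\<beta> - c) \<le> w x y"
        proof (rule ccontr)
          assume "\<not> ?thesis"
          then have "w x y - 1/2 + \<beta> < c" by simp
          then obtain y' where y': "y' \<in> S" "w x y - 1/2 + \<beta> < y'"
            unfolding c_def using less_cSup_iff[OF _ bdd] y1 by blast
          have "1/2 - cap \<theta> + cap y' \<le> w x y"
            using dd_cu[of x y y'] hi[OF y(1) 3] y'(1) S[OF y'(1)] 3 by (auto simp: S_def)
          moreover have "cap \<theta> - cap y' \<le> \<beta> - y'" using b S[OF y'(1)] by (auto simp: cap_def)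
          ultimately show False using y'(2) by simp
        qed
        then show ?thesis using 3 c secB_nonneg[of y] by simp
      qed
    qed
  qed
  also have "(\<integral>y. ?f y \<partial>unif) = (J - (\<integral>y. secB y \<partial>unif)) + (5/4 * (\<beta> - c) + (c - \<beta>) * (1 - \<beta>))"
  proof -
    have 1: "(\<integral>y. J - secB y \<partial>unif) = J - (\<integral>y. secB y \<partial>unif)"
      by (subst Bochner_Integration.integral_diff) (use integrable_secB in \<open>auto simp: unif.prob_space[simplified]\<close>)
    have 2: "(\<integral>y. 5/4 * indicator {c<..<\<beta>} y + (c - \<beta>) * indicator {\<beta><..} y \<partial>unif) =
        5/4 * (\<beta> - c) + (c - \<beta>) * (1 - \<beta>)"
    proof -
      have "(\<integral>y. 5/4 * indicator {c<..<\<beta>} y \<partial>unif) = 5/4 * (\<beta> - c)"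
        by (rule integral_ind) (use b c in auto)
      moreover have "(\<integral>y. (c - \<beta>) * indicator {\<beta><..} y \<partial>unif) = (c - \<beta>) * (1 - \<beta>)"
        by (rule integral_ind_Ioi) (use b in auto)
      ultimately show ?thesis
        by (subst Bochner_Integration.integral_add, (intro integrable_ind; simp)+) simp
    qed
    show ?thesis unfolding 1[symmetric] 2[symmetric]
      by (rule Bochner_Integration.integral_add)
        (intro Bochner_Integration.integrable_add Bochner_Integration.integrable_diff integrable_secB integrable_ind; simp)+
  qed
  also have "(J - (\<integral>y. secB y \<partial>unif)) \<le> \<dots>"
  proof -
    have "0 \<le> (\<beta> - c) * (1/4 + \<beta>)" using b c by simp
    also have "(\<beta> - c) * (1/4 + \<beta>) = 5/4 * (\<beta> - c) + (c - \<beta>) * (1 - \<beta>)"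
      by (simp add: field_simps)
    finally show ?thesis by linarith
  qed
  finally show ?thesis by simp
qed

text \<open>In a \<open>dcol\<close> column \<open>A\<close> has no points, so the two preceding
  column bounds suffice; in the others \<open>pointwise\<close> is integrated.\<close>

lemma column:
  assumes x: "0 < x" "x < 1" "x \<notin> R"
  shows "J - secA x - (\<integral>y. secB y \<partial>unif) + (\<integral>y. indicator (A \<inter> B) (x, y) \<partial>unif) \<le> (\<integral>y. w x y \<partial>unif)"
proof (cases "dcol x")
  case True
  then have "(x, y) \<notin> A" for y by (simp add: A_def)
  then have "secA x = 0" "(\<integral>y. indicator (A \<inter> B) (x, y) \<partial>unif) = (0 :: real)" by (simp_all add: secA_def)
  moreover have "0 \<le> (\<integral>y. secB y \<partial>unif)" using secB_nonneg by (simp add: Bochner_Integration.integral_nonneg)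
  ultimately show ?thesis
    using column_no_loss[OF x True] column_loss[OF x True] by (cases "\<exists>y. cu x y") auto
next
  case False
  have AB: "A \<inter> B \<in> sets (unif \<Otimes>\<^sub>M unif)" using A_meas B_meas by auto
  have iAB: "integrable unif (\<lambda>y. indicator (A \<inter> B) (x, y) :: real)"
  proof (rule unif.integrable_const_bound[where B = 1])
    show "(\<lambda>y. indicator (A \<inter> B) (x, y) :: real) \<in> borel_measurable unif"
      using measurable_compose[OF measurable_Pair1'[of x unif unif] borel_measurable_indicator[OF AB]] by auto
  qed auto
  have "(\<integral>y. (J - secA x) - secB y + indicator (A \<inter> B) (x, y) \<partial>unif) \<le> (\<integral>y. w x y \<partial>unif)"
  proof (rule integral_mono_AE[OF _ integrable_w])
    show "integrable unif (\<lambda>y. (J - secA x) - secB y + indicator (A \<inter> B) (x, y))"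
      by (intro Bochner_Integration.integrable_add Bochner_Integration.integrable_diff integrable_secB iAB) auto
    show "AE y in unif. (J - secA x) - secB y + indicator (A \<inter> B) (x, y) \<le> w x y"
      using AE_gen[OF x] by eventually_elim (use pointwise[OF _ False] in auto)
  qed
  also have "(\<integral>y. (J - secA x) - secB y + indicator (A \<inter> B) (x, y) \<partial>unif) =
      (\<integral>y. (J - secA x) - secB y \<partial>unif) + (\<integral>y. indicator (A \<inter> B) (x, y) \<partial>unif)"
    by (rule Bochner_Integration.integral_add)
      (intro Bochner_Integration.integrable_diff integrable_secB iAB; simp)+
  also have "(\<integral>y. (J - secA x) - secB y \<partial>unif) = (J - secA x) - (\<integral>y. secB y \<partial>unif)"
    by (subst Bochner_Integration.integral_diff) (use integrable_secB in \<open>auto simp: unif.prob_space[simplified]\<close>)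
  finally show ?thesis by simp
qed

section \<open>Integration over both ranks\<close>

lemma integrable_w_fst: "integrable unif (\<lambda>x. \<integral>y. w x y \<partial>unif)"
proof -
  have "integrable (unif \<Otimes>\<^sub>M unif) (\<lambda>p. w (fst p) (snd p))"
    by (rule UU.integrable_const_bound[where B = K]) (use w_bound measurable_UU[OF w_meas] in auto)
  from UU.integrable_fst'[OF this] show ?thesis by simp
qed

text \<open>Integrating \<open>column\<close> over \<open>x\<close> and applying inclusion-exclusion
  leaves the measure of \<open>A \<union> B\<close> as the total loss, and both regions lie in the
  triangle.\<close>

lemma square_bound: "J - J\<^sup>2 / 2 \<le> (\<integral>x. \<integral>y. w x y \<partial>unif \<partial>unif)"
proof -
  have AB: "A \<inter> B \<in> sets (unif \<Otimes>\<^sub>M unif)" "A \<union> B \<in> sets (unif \<Otimes>\<^sub>M unif)" using A_meas B_meas by auto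
  let ?P = "measure (unif \<Otimes>\<^sub>M unif)"
  have fst_int: "(\<integral>x. \<integral>y. indicator S (x, y) \<partial>unif \<partial>unif) = ?P S" if "S \<in> sets (unif \<Otimes>\<^sub>M unif)" for S
    using UU.integral_fst'[OF integrable_indP[OF that]] that
    by (simp add: sets.Int_space_eq2)
  have PA: "(\<integral>x. secA x \<partial>unif) = ?P A"
    using fst_int[OF A_meas] by (simp add: secA_eq[abs_def])
  have PB: "(\<integral>y. secB y \<partial>unif) = ?P B"
    using UU.Fubini_integral[of "\<lambda>x y. indicator B (x, y) :: real"] integrable_indP[OF B_meas] fst_int[OF B_meas]
    by (simp add: secB_eq[abs_def])
  let ?k = "\<lambda>x. \<integral>y. indicator (A \<inter> B) (x, y) \<partial>unif :: real"
  have ik: "integrable unif ?k"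
    using UU.integrable_fst'[OF integrable_indP[OF AB(1)]] by simp
  have "(\<integral>x. ((J - ?P B) - secA x) + ?k x \<partial>unif) \<le> (\<integral>x. \<integral>y. w x y \<partial>unif \<partial>unif)"
  proof (rule integral_mono_AE[OF _ integrable_w_fst])
    show "integrable unif (\<lambda>x. ((J - ?P B) - secA x) + ?k x)"
      by (intro Bochner_Integration.integrable_add Bochner_Integration.integrable_diff integrable_secA ik) auto
    show "AE x in unif. ((J - ?P B) - secA x) + ?k x \<le> (\<integral>y. w x y \<partial>unif)"
      using AE_unif_range AE_unif_finite[OF finR]
    proof eventually_elim
      fix x assume "0 < x \<and> x < 1" "x \<notin> R"
      then show "((J - ?P B) - secA x) + ?k x \<le> (\<integral>y. w x y \<partial>unif)"
        using column[of x] PB by simp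
    qed
  qed
  also have "(\<integral>x. ((J - ?P B) - secA x) + ?k x \<partial>unif) = (\<integral>x. (J - ?P B) - secA x \<partial>unif) + (\<integral>x. ?k x \<partial>unif)"
    by (rule Bochner_Integration.integral_add)
      (intro Bochner_Integration.integrable_diff integrable_secA ik; simp)+
  also have "(\<integral>x. (J - ?P B) - secA x \<partial>unif) = (J - ?P B) - ?P A"
    by (subst Bochner_Integration.integral_diff) (use integrable_secA PA in \<open>auto simp: unif.prob_space[simplified]\<close>)
  also have "(\<integral>x. ?k x \<partial>unif) = ?P (A \<inter> B)" by (rule fst_int[OF AB(1)])
  finally have main: "(J - ?P B) - ?P A + ?P (A \<inter> B) \<le> (\<integral>x. \<integral>y. w x y \<partial>unif \<partial>unif)" .
  have union: "?P (A \<union> B) = ?P A + ?P B - ?P (A \<inter> B)"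
    using UU.finite_measure_Union'[OF A_meas B_meas] UU.finite_measure_Diff'[OF B_meas A_meas]
    by (simp add: Int_commute)
  have T: "?P {(x, y). 0 < x \<and> 0 < y \<and> x + y < J} = J\<^sup>2 / 2"
    by (rule measure_triangle) auto
  have "?P (A \<union> B) \<le> ?P {(x, y). 0 < x \<and> 0 < y \<and> x + y < J}"
  proof (rule UU.finite_measure_mono)
    show "{(x, y). 0 < x \<and> 0 < y \<and> x + y < J} \<in> UU.events"
    \<comment> \<open>A set outside the sigma-algebra has \<open>measure\<close> 0 by convention,
      but \<open>T\<close> gives a positive value.\<close>
    proof (rule ccontr)
      assume "\<not> ?thesis"
      then show False using T by (simp add: measure_notin_sets)
    qed
  qed (auto simp: A_def B_def)
  then show ?thesis using main union T by simp
qed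

end

subsection \<open>Runs of Ranking\<close>

text \<open>\<open>drun\<close> is Ranking with each edge recorded as the pair of its active and its passive vertex.
  \<^const>\<open>arg_min_on\<close> is a choice, so comparing runs needs distinct ranks.\<close>

definition matched :: "('v \<times> 'v) set \<Rightarrow> 'v set" where
  "matched M = fst ` M \<union> snd ` M"

definition free_nbrs :: "'v set set \<Rightarrow> 'v \<Rightarrow> 'v set \<Rightarrow> 'v set" where
  "free_nbrs E a U = {b. {b, a} \<in> E \<and> b \<notin> U}"

fun dstep :: "'v set set \<Rightarrow> ('v \<Rightarrow> real) \<Rightarrow> 'v event \<Rightarrow> ('v \<times> 'v) set \<Rightarrow> ('v \<times> 'v) set" where
  "dstep E y (Arrival a) M = M"
| "dstep E y (Deadline a) M =
     (let N = free_nbrs E a (matched M)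
      in if a \<notin> matched M \<and> N \<noteq> {} then insert (a, arg_min_on y N) M else M)"

definition drun :: "'v set set \<Rightarrow> ('v \<Rightarrow> real) \<Rightarrow> 'v event list \<Rightarrow> ('v \<times> 'v) set" where
  "drun E y evs = fold (dstep E y) evs {}"

text \<open>Deletion keeps the event list: the deadline of a deleted vertex finds no neighbours and
  does nothing, so runs with and without it can be compared event by event.\<close>

definition del :: "'v set \<Rightarrow> 'v set set \<Rightarrow> 'v set set" where
  "del X E = {e \<in> E. e \<inter> X = {}}"

lemma drun_Nil [simp]: "drun E y [] = {}"
  by (simp add: drun_def)

lemma drun_snoc [simp]: "drun E y (evs @ [e]) = dstep E y e (drun E y evs)"
  by (simp add: drun_def)

lemma matched_empty [simp]: "matched {} = {}"
  by (simp add: matched_def)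

lemma matched_insert [simp]: "matched (insert (a, b) M) = insert a (insert b (matched M))"
  by (auto simp: matched_def)

lemma matchedI: "(a, b) \<in> M \<Longrightarrow> a \<in> matched M" "(a, b) \<in> M \<Longrightarrow> b \<in> matched M"
  by (force simp: matched_def)+

lemma matchedE:
  assumes "a \<in> matched M"
  obtains b where "(a, b) \<in> M" | b where "(b, a) \<in> M"
  using assms by (auto simp: matched_def)

lemma free_nbrs_del: "a \<notin> X \<Longrightarrow> free_nbrs (del X E) a U = free_nbrs E a U - X"
  by (auto simp: free_nbrs_def del_def)

lemma free_nbrs_del_empty: "a \<in> X \<Longrightarrow> free_nbrs (del X E) a U = {}"
  by (auto simp: free_nbrs_def del_def)

lemma dstep_mono: "M \<subseteq> dstep E y e M"
  by (cases e) (auto simp: Let_def)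

lemma drun_mono: "drun E y evs \<subseteq> drun E y (evs @ evs')"
proof (induction evs' rule: rev_induct)
  case (snoc e evs')
  then show ?case
    using dstep_mono[of "drun E y (evs @ evs')" E y e]
    by (metis append_assoc drun_snoc order_trans)
qed simp

lemma arg_min_on_eqI:
  assumes "p \<in> S" "\<And>q. q \<in> S \<Longrightarrow> q \<noteq> p \<Longrightarrow> y p < (y q :: real)"
  shows "arg_min_on y S = p"
proof -
  have "is_arg_min y (\<lambda>x. x \<in> S) q \<longleftrightarrow> q = p" for q
  proof
    assume *: "is_arg_min y (\<lambda>x. x \<in> S) q"
    show "q = p"
    proof (rule ccontr)
      assume "q \<noteq> p"
      then have "y p < y q" using * assms(2) by (simp add: is_arg_min_def)
      then show False using * assms(1) by (simp add: is_arg_min_def)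
    qed
  next
    assume q: "q = p"
    have "\<not> y r < y p" if "r \<in> S" for r
      using assms(2)[OF that] by (cases "r = p") auto
    then show "is_arg_min y (\<lambda>x. x \<in> S) q"
      using assms(1) q by (simp add: is_arg_min_def)
  qed
  then have "is_arg_min y (\<lambda>x. x \<in> S) = (\<lambda>q. q = p)" by (simp add: fun_eq_iff)
  then show ?thesis unfolding arg_min_on_def arg_min_def by simp
qed

lemma arg_min_on_cong:
  assumes "\<And>q. q \<in> S \<Longrightarrow> y q = y' q"
  shows "arg_min_on y S = arg_min_on (y' :: 'v \<Rightarrow> real) S"
proof -
  have "is_arg_min y (\<lambda>x. x \<in> S) = is_arg_min y' (\<lambda>x. x \<in> S)"
    using assms by (auto simp: is_arg_min_def fun_eq_iff)
  then show ?thesis unfolding arg_min_on_def arg_min_def by simp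
qed

section \<open>Structure of a single run\<close>

locale simple_graph =
  fixes V :: "'v set" and E :: "'v set set"
  assumes finV: "finite V"
    and edge: "\<And>e. e \<in> E \<Longrightarrow> e \<subseteq> V \<and> card e = 2"
begin

lemma edge_ends: "{a, b} \<in> E \<Longrightarrow> a \<in> V \<and> b \<in> V \<and> a \<noteq> b"
  using edge[of "{a, b}"] by (cases "a = b") auto

lemma free_nbrs_sub: "free_nbrs E a U \<subseteq> V - U"
  using edge_ends by (auto simp: free_nbrs_def)

lemma fin_free_nbrs: "finite (free_nbrs E a U)"
  using free_nbrs_sub finV by (meson Diff_subset finite_subset)

lemma arg_min_free:
  assumes "free_nbrs E a U \<noteq> {}"
  shows "arg_min_on y (free_nbrs E a U) \<in> free_nbrs E a U"
    and "b \<in> free_nbrs E a U \<Longrightarrow> (y (arg_min_on y (free_nbrs E a U)) :: real) \<le> y b"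
  using arg_min_if_finite(1)[OF fin_free_nbrs assms, of y] arg_min_least[OF fin_free_nbrs assms, of _ y]
  by auto

lemma arg_min_free_less:
  assumes "inj_on y V" "b \<in> free_nbrs E a U" "b \<noteq> arg_min_on y (free_nbrs E a U)"
  shows "(y (arg_min_on y (free_nbrs E a U)) :: real) < y b"
proof -
  have ne: "free_nbrs E a U \<noteq> {}" using assms(2) by auto
  have "y (arg_min_on y (free_nbrs E a U)) \<noteq> y b"
    using assms arg_min_free(1)[OF ne, of y] free_nbrs_sub[of a U]
    by (metis Diff_iff inj_on_eq_iff subsetD)
  then show ?thesis using arg_min_free(2)[OF ne assms(2), of y] by simp
qed

lemma arg_min_free_subset:
  assumes "inj_on y V" "S \<subseteq> free_nbrs E a U" "arg_min_on y (free_nbrs E a U) \<in> S"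
  shows "arg_min_on (y :: 'v \<Rightarrow> real) S = arg_min_on y (free_nbrs E a U)"
  by (rule arg_min_on_eqI) (use assms arg_min_free_less[OF assms(1)] in auto)

lemma del_simple_graph: "simple_graph V (del X E)"
  using finV edge by unfold_locales (auto simp: del_def)

lemma drun_edge: "(a, p) \<in> drun E y evs \<Longrightarrow> {a, p} \<in> E"
proof (induction evs rule: rev_induct)
  case (snoc e evs)
  show ?case
  proof (cases "(a, p) \<in> drun E y evs")
    case False
    then have "p = arg_min_on y (free_nbrs E a (matched (drun E y evs)))"
      "free_nbrs E a (matched (drun E y evs)) \<noteq> {}"
      using snoc.prems by (cases e; simp add: Let_def split: if_splits)+
    then have "p \<in> free_nbrs E a (matched (drun E y evs))" using arg_min_free(1) by simp
    then show ?thesis by (simp add: free_nbrs_def insert_commute)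
  qed (use snoc in simp)
qed simp

lemma drun_V: "(a, p) \<in> drun E y evs \<Longrightarrow> a \<in> V \<and> p \<in> V \<and> a \<noteq> p"
  using drun_edge edge_ends by blast

lemma drun_matching:
  assumes "(a, p) \<in> drun E y evs" "(b, q) \<in> drun E y evs" "{a, p} \<inter> {b, q} \<noteq> {}"
  shows "a = b \<and> p = q"
  using assms
proof (induction evs rule: rev_induct)
  case (snoc e evs)
  show ?case
  proof (cases e)
    case (Arrival x1)
    then show ?thesis using snoc by simp
  next
    case (Deadline c)
    let ?M = "drun E y evs" and ?N = "free_nbrs E c (matched (drun E y evs))"
    show ?thesis
    proof (cases "c \<notin> matched ?M \<and> ?N \<noteq> {}")
      case free: True
      then have p: "arg_min_on y ?N \<notin> matched ?M" "arg_min_on y ?N \<noteq> c"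
        using arg_min_free(1)[of c "matched ?M" y] edge_ends by (auto simp: free_nbrs_def)
      have st: "dstep E y e ?M = insert (c, arg_min_on y ?N) ?M"
        using free Deadline by (simp add: Let_def)
      show ?thesis
      proof (cases "(a, p) \<in> ?M \<and> (b, q) \<in> ?M")
        case True
        then show ?thesis using snoc by blast
      next
        case False
        have "{a', p'} \<inter> {c, arg_min_on y ?N} = {}" if "(a', p') \<in> ?M" for a' p'
          using matchedI[OF that] p free by auto
        moreover have "(a, p) \<in> insert (c, arg_min_on y ?N) ?M" "(b, q) \<in> insert (c, arg_min_on y ?N) ?M"
          using snoc.prems(1,2) unfolding drun_snoc st .
        ultimately show ?thesis using snoc.prems(3) False by fast
      qed
    next
      case False
      then have "dstep E y e ?M = ?M" using Deadline by (auto simp: Let_def)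
      then show ?thesis using snoc unfolding drun_snoc by simp
    qed
  qed
qed simp

text \<open>No matched pair is split by \<open>X\<close>. At a deadline outside \<open>X\<close> the
  pick is outside \<open>X\<close> too, so it remains the minimum after the candidates in
  \<open>X\<close> are removed.\<close>

lemma drun_del:
  assumes inj: "inj_on y V" and X: "\<And>a p. (a, p) \<in> drun E y evs \<Longrightarrow> a \<in> X \<longleftrightarrow> p \<in> X"
  shows "drun (del X E) y evs = {(a, p) \<in> drun E y evs. a \<notin> X}"
  using X
proof (induction evs rule: rev_induct)
  case (snoc e evs)
  have IH: "drun (del X E) y evs = {(a, p) \<in> drun E y evs. a \<notin> X}"
    using snoc.IH snoc.prems drun_mono[of E y evs "[e]"] by blast
  have X': "\<And>a p. (a, p) \<in> drun E y evs \<Longrightarrow> a \<in> X \<longleftrightarrow> p \<in> X"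
    using snoc.prems drun_mono[of E y evs "[e]"] by blast
  show ?case
  proof (cases e)
    case (Arrival c)
    then show ?thesis using IH by simp
  next
    case (Deadline c)
    let ?M = "drun E y evs" and ?M' = "drun (del X E) y evs"
    let ?N = "free_nbrs E c (matched ?M)" and ?N' = "free_nbrs (del X E) c (matched ?M')"
    have mm: "a \<in> matched ?M' \<longleftrightarrow> a \<in> matched ?M" if "a \<notin> X" for a
      unfolding IH using that X' by (fastforce simp: matched_def image_iff)
    show ?thesis
    proof (cases "c \<in> X")
      case True
      then have "drun (del X E) y (evs @ [e]) = ?M'"
        using Deadline by (simp add: free_nbrs_del_empty)
      then show ?thesis using IH True Deadline by (auto simp: Let_def)
    next
      case False
      have N': "?N' = ?N - X"
        using free_nbrs_del[OF False] mm by (auto simp: free_nbrs_def)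
      show ?thesis
      proof (cases "c \<notin> matched ?M \<and> ?N \<noteq> {}")
        case True
        let ?p = "arg_min_on y ?N"
        have st: "drun E y (evs @ [e]) = insert (c, ?p) ?M"
          using True Deadline by (simp add: Let_def)
        then have "?p \<notin> X" using snoc.prems[of c ?p] False by auto
        moreover have "?p \<in> ?N" using arg_min_free(1) True by blast
        ultimately have pN: "?p \<in> ?N'" using N' by blast
        have "arg_min_on y ?N' = ?p"
          by (rule arg_min_free_subset[OF inj]) (use pN N' in auto)
        then have "drun (del X E) y (evs @ [e]) = insert (c, ?p) ?M'"
          using Deadline True mm[OF False] pN by (auto simp: Let_def)
        then show ?thesis unfolding st using IH False by auto
      next
        case no: False
        then have "drun E y (evs @ [e]) = ?M" using Deadline by (auto simp: Let_def)
        moreover have "drun (del X E) y (evs @ [e]) = ?M'"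
          using no Deadline N' mm[OF False] by (auto simp: Let_def)
        ultimately show ?thesis using IH by simp
      qed
    qed
  qed
qed simp

lemma drun_cong:
  assumes "\<And>a. a \<in> \<Union>E \<Longrightarrow> y a = y' a"
  shows "drun E y evs = drun E y' evs"
proof (induction evs rule: rev_induct)
  case (snoc e evs)
  have "arg_min_on y (free_nbrs E c U) = arg_min_on y' (free_nbrs E c U)" for c U
  proof (rule arg_min_on_cong)
    fix q assume "q \<in> free_nbrs E c U"
    then have "q \<in> \<Union>E" unfolding free_nbrs_def by blast
    then show "y q = y' q" by (rule assms)
  qed
  then show ?case using snoc by (cases e) (auto simp: Let_def)
qed simp

lemma drun_del_unmatched:
  assumes "inj_on y V" "a \<notin> matched (drun E y evs)"
  shows "drun (del {a} E) y evs = drun E y evs"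
proof -
  have no: "b \<noteq> a \<and> p \<noteq> a" if "(b, p) \<in> drun E y evs" for b p
    using matchedI[OF that] assms(2) by auto
  have "drun (del {a} E) y evs = {(b, p) \<in> drun E y evs. b \<notin> {a}}"
    by (rule drun_del[OF assms(1)]) (use no in auto)
  then show ?thesis using no by auto
qed

lemma drun_del_upd:
  assumes "\<And>b. b \<noteq> a \<Longrightarrow> y b = y' b" "a \<in> X"
  shows "drun (del X E) y evs = drun (del X E) y' evs"
proof -
  interpret D: simple_graph V "del X E" by (rule del_simple_graph)
  show ?thesis
  proof (rule D.drun_cong)
    fix b assume "b \<in> \<Union>(del X E)"
    then have "b \<notin> X" by (auto simp: del_def)
    then show "y b = y' b" using assms by metis
  qed
qed

text \<open>A candidate that loses the minimum at its old rank also loses it at a larger one, so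
  every pick stays the same.\<close>

lemma drun_raise:
  assumes inj: "inj_on y V" "inj_on y' V"
    and eq: "\<And>b. b \<noteq> a \<Longrightarrow> y b = y' b" and le: "y a \<le> y' a"
    and np: "\<And>c. (c, a) \<notin> drun E y evs"
  shows "drun E y' evs = drun E y evs"
  using np
proof (induction evs rule: rev_induct)
  case (snoc e evs)
  have IH: "drun E y' evs = drun E y evs"
    using snoc.IH snoc.prems drun_mono[of E y evs "[e]"] by blast
  show ?case
  proof (cases e)
    case (Arrival c)
    then show ?thesis using IH by simp
  next
    case (Deadline c)
    let ?N = "free_nbrs E c (matched (drun E y evs))"
    have "arg_min_on y' ?N = arg_min_on y ?N" if "c \<notin> matched (drun E y evs)" "?N \<noteq> {}"
    proof (rule arg_min_on_eqI)
      have pa: "arg_min_on y ?N \<noteq> a"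
        using snoc.prems[of c] that Deadline by (auto simp: Let_def)
      show "arg_min_on y ?N \<in> ?N" using arg_min_free(1) that by blast
      fix q assume "q \<in> ?N" "q \<noteq> arg_min_on y ?N"
      then have "y (arg_min_on y ?N) < y q" using arg_min_free_less[OF inj(1)] by blast
      then show "y' (arg_min_on y ?N) < y' q"
        using eq[OF pa] eq[of q] le by (cases "q = a") auto
    qed
    then show ?thesis using IH Deadline by (auto simp: Let_def)
  qed
qed simp

lemma drun_split:
  assumes "(w, a) \<in> drun E y evs"
  obtains pre post where "evs = pre @ Deadline w # post" "w \<notin> matched (drun E y pre)"
    "a \<in> free_nbrs E w (matched (drun E y pre))"
    "a = arg_min_on y (free_nbrs E w (matched (drun E y pre)))"
  using assms
proof (induction evs arbitrary: thesis rule: rev_induct)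
  case (snoc e evs)
  show ?case
  proof (cases "(w, a) \<in> drun E y evs")
    case True
    then obtain pre post where "evs = pre @ Deadline w # post" "w \<notin> matched (drun E y pre)"
    "a \<in> free_nbrs E w (matched (drun E y pre))"
    "a = arg_min_on y (free_nbrs E w (matched (drun E y pre)))"
      using snoc.IH by metis
    then show ?thesis using snoc.prems(1)[of pre "post @ [e]"] by simp
  next
    case False
    then have "e = Deadline w" "w \<notin> matched (drun E y evs)"
      "free_nbrs E w (matched (drun E y evs)) \<noteq> {}"
      "a = arg_min_on y (free_nbrs E w (matched (drun E y evs)))"
      using snoc.prems(2) by (cases e; auto simp: Let_def split: if_splits)+
    then show ?thesis using snoc.prems(1)[of evs "[]"] arg_min_free(1) by auto
  qed
qed simp

lemma drun_deadline:
  assumes "evs = pre @ Deadline w # post" "w \<notin> matched (drun E y pre)"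
    "free_nbrs E w (matched (drun E y pre)) \<noteq> {}"
  shows "(w, arg_min_on y (free_nbrs E w (matched (drun E y pre)))) \<in> drun E y evs"
proof -
  have "(w, arg_min_on y (free_nbrs E w (matched (drun E y pre)))) \<in> drun E y (pre @ [Deadline w])"
    using assms by (simp add: Let_def)
  then show ?thesis using drun_mono[of E y "pre @ [Deadline w]" post] assms(1) by auto
qed

lemma drun_maximal:
  assumes "{a, b} \<in> E" "Deadline a \<in> set evs"
  shows "a \<in> matched (drun E y evs) \<or> b \<in> matched (drun E y evs)"
proof (rule ccontr)
  assume *: "\<not> ?thesis"
  obtain pre post where evs: "evs = pre @ Deadline a # post"
    using assms(2) by (meson split_list)
  have "matched (drun E y pre) \<subseteq> matched (drun E y evs)"
    using drun_mono[of E y pre "Deadline a # post"] evs by (auto simp: matched_def)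
  then have "a \<notin> matched (drun E y pre)" "b \<in> free_nbrs E a (matched (drun E y pre))"
    using * assms(1) by (auto simp: free_nbrs_def insert_commute)
  then show False
    using matchedI(1)[OF drun_deadline[OF evs]] * by blast
qed

text \<open>A vertex unmatched at the end was free at every deadline, hence among the candidates
  when \<open>b\<close> picked \<open>p\<close>.\<close>

lemma drun_stable:
  assumes "(b, p) \<in> drun E y evs" "{a, b} \<in> E" "a \<notin> matched (drun E y evs)"
  shows "y p \<le> y a"
proof -
  from assms(1) obtain pre post where evs: "evs = pre @ Deadline b # post"
    "p = arg_min_on y (free_nbrs E b (matched (drun E y pre)))"
    by (rule drun_split)
  have "matched (drun E y pre) \<subseteq> matched (drun E y evs)"
    using drun_mono[of E y pre "Deadline b # post"] evs by (auto simp: matched_def)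
  then have "a \<in> free_nbrs E b (matched (drun E y pre))"
    using assms by (auto simp: free_nbrs_def)
  then show ?thesis using arg_min_free(2) evs(2) by blast
qed

subsection \<open>Deleting a vertex\<close>

text \<open>A deadline seen on the set of matched vertices alone; the choice made there depends on
  the earlier pairs only through this set.\<close>

definition ustep :: "('v \<Rightarrow> real) \<Rightarrow> 'v \<Rightarrow> 'v set \<Rightarrow> 'v set" where
  "ustep y a U = (if a \<notin> U \<and> free_nbrs E a U \<noteq> {}
     then insert a (insert (arg_min_on y (free_nbrs E a U)) U) else U)"

text \<open>One step of the alternating path. The difference \<open>z\<close> persists or
  disappears, unless \<open>z\<close> is the acting vertex or its pick; then it may pass to the
  partner of \<open>z\<close>, to \<open>a\<close>, or to the replacement picked by
  \<open>a\<close>.\<close>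

lemma ustep_insert:
  assumes inj: "inj_on y V" and z: "z \<notin> U"
  shows "\<exists>c. ustep y a U \<subseteq> insert c (ustep y a (insert z U)) \<and>
             ustep y a (insert z U) \<subseteq> insert c (ustep y a U) \<and>
             (ustep y a U \<subseteq> ustep y a (insert z U) \<or> ustep y a (insert z U) \<subseteq> ustep y a U)"
proof -
  let ?N = "free_nbrs E a U" and ?N' = "free_nbrs E a (insert z U)"
  have N': "?N' = ?N - {z}" by (auto simp: free_nbrs_def)
  consider "a = z" | "a \<in> U" | "a \<notin> insert z U" "?N = {}"
    | "a \<notin> insert z U" "?N \<noteq> {}" "arg_min_on y ?N \<noteq> z" | "a \<notin> insert z U" "?N \<noteq> {}" "arg_min_on y ?N = z"
    by blast
  then show ?thesis
  proof cases
    case 1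
    then have "ustep y a (insert z U) = insert z U" by (simp add: ustep_def)
    moreover have "ustep y a U = U \<or> (\<exists>p. ustep y a U = insert z (insert p U))"
      using 1 by (auto simp: ustep_def)
    ultimately show ?thesis by blast
  next
    case 2
    then show ?thesis by (auto simp: ustep_def)
  next
    case 3
    then show ?thesis using N' by (auto simp: ustep_def)
  next
    case 4
    have p: "arg_min_on y ?N \<in> ?N'" using arg_min_free(1)[OF 4(2), of y] N' 4(3) by blast
    have "arg_min_on y ?N' = arg_min_on y ?N"
      by (rule arg_min_free_subset[OF inj]) (use p N' in auto)
    then show ?thesis using 4 p by (auto simp: ustep_def)
  next
    case 5
    then have U: "ustep y a U = insert a (insert z U)" by (simp add: ustep_def)
    have "ustep y a (insert z U) = insert z U \<or>
        (\<exists>p. ustep y a (insert z U) = insert a (insert p (insert z U)))"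
      by (auto simp: ustep_def)
    then show ?thesis unfolding U by blast
  qed
qed

definition close :: "'v set \<Rightarrow> 'v set \<Rightarrow> bool" where
  "close U U' \<longleftrightarrow> U = U' \<or> (\<exists>z. z \<notin> U \<and> U' = insert z U) \<or> (\<exists>z. z \<notin> U' \<and> U = insert z U')"

lemma close_ustep:
  assumes inj: "inj_on y V" and "close U U'"
  shows "close (ustep y a U) (ustep y a U')"
proof -
  have cl: "close A B" if "A \<subseteq> insert c B" "B \<subseteq> insert c A" "A \<subseteq> B \<or> B \<subseteq> A" for A B c
  proof (cases "A \<subseteq> B")
    case True
    then have "A = B \<or> c \<notin> A \<and> B = insert c A" using that by blast
    then show ?thesis unfolding close_def by blast
  next
    case False
    then have "A = B \<or> c \<notin> B \<and> A = insert c B" using that by blast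
    then show ?thesis unfolding close_def by blast
  qed
  have sym: "close A B \<Longrightarrow> close B A" for A B unfolding close_def by blast
  have one: "close (ustep y a A) (ustep y a (insert z A))" if "z \<notin> A" for z A
    using ustep_insert[OF inj that, of a] cl by blast
  show ?thesis
  proof -
    consider "U = U'" | z where "z \<notin> U" "U' = insert z U" | z where "z \<notin> U'" "U = insert z U'"
      using assms(2) unfolding close_def by blast
    then show ?thesis
    proof cases
      case 1
      then show ?thesis by (simp add: close_def)
    qed (use one sym in blast)+
  qed
qed

text \<open>Deleting \<open>w\<close> amounts to declaring it matched from the start. Both sides
  then evolve by \<open>ustep\<close>, starting from \<open>{}\<close> and \<open>{w}\<close>, which
  are close.\<close>

lemma drun_close:
  assumes inj: "inj_on y V"
  shows "close (matched (drun E y evs)) (insert w (matched (drun (del {w} E) y evs)))"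
proof (induction evs rule: rev_induct)
  case Nil
  then show ?case by (auto simp: close_def)
next
  case (snoc e evs)
  show ?case
  proof (cases e)
    case (Arrival c)
    then show ?thesis using snoc by simp
  next
    case (Deadline c)
    let ?M = "drun E y evs" and ?M' = "drun (del {w} E) y evs"
    have "matched (drun E y (evs @ [e])) = ustep y c (matched ?M)"
      using Deadline by (auto simp: ustep_def Let_def)
    moreover have "insert w (matched (drun (del {w} E) y (evs @ [e]))) = ustep y c (insert w (matched ?M'))"
    proof (cases "c = w")
      case True
      then show ?thesis using Deadline
        by (auto simp: ustep_def Let_def free_nbrs_del_empty)
    next
      case False
      then have "free_nbrs (del {w} E) c (matched ?M') = free_nbrs E c (insert w (matched ?M'))"
        by (auto simp: free_nbrs_def del_def)
      then show ?thesis using Deadline False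
        by (auto simp: ustep_def Let_def)
    qed
    ultimately show ?thesis using close_ustep[OF inj snoc] by simp
  qed
qed

subsection \<open>Victims\<close>

definition victim :: "'v event list \<Rightarrow> ('v \<Rightarrow> real) \<Rightarrow> 'v \<Rightarrow> 'v \<Rightarrow> bool" where
  "victim evs y w a \<longleftrightarrow> {w, a} \<in> E \<and> a \<notin> matched (drun E y evs) \<and> a \<in> matched (drun (del {w} E) y evs)"

text \<open>Victims lie in the second of two close sets but not in the first, which leaves room for
  one vertex only.\<close>

lemma victim_unique:
  assumes "inj_on y V" "victim evs y w a" "victim evs y w b"
  shows "a = b"
proof -
  let ?U = "matched (drun E y evs)" and ?U' = "insert w (matched (drun (del {w} E) y evs))"
  have ab: "a \<notin> ?U" "b \<notin> ?U" "a \<in> ?U'" "b \<in> ?U'" using assms(2,3) by (auto simp: victim_def)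
  consider "?U = ?U'" | z where "?U' = insert z ?U" | z where "?U = insert z ?U'"
    using drun_close[OF assms(1), of evs w] unfolding close_def by blast
  then show ?thesis
  proof cases
    case (2 z)
    have "a = z" "b = z" using ab unfolding 2 by blast+
    then show ?thesis by simp
  qed (use ab in blast)+
qed

text \<open>Let \<open>a\<close> be matched passively by \<open>w\<close> while its neighbour \<open>b\<close> loses. If a larger rank leaves \<open>a\<close>
  unmatched, then deleting \<open>w\<close> from that run reproduces the first run except that \<open>a\<close> is still free,
  so \<open>a\<close> gets matched.\<close>

lemma victim_of_rank_increase:
  assumes inj: "inj_on y V" "inj_on y' V"
    and dl: "\<And>c. c \<in> V \<Longrightarrow> Deadline c \<in> set evs"
    and eq: "\<And>c. c \<noteq> a \<Longrightarrow> y c = y' c" and lt: "y a < y' a"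
    and wa: "(w, a) \<in> drun E y evs" and a: "a \<notin> matched (drun E y' evs)" and ab: "{a, b} \<in> E"
    and b: "b \<notin> matched (drun E y evs) \<or> (\<exists>p. (b, p) \<in> drun E y evs \<and> y' a < y p)"
  obtains r where "(w, r) \<in> drun E y' evs" "y a < y' r" "victim evs y' w a" "w \<noteq> b"
proof -
  let ?M = "drun E y evs" and ?M' = "drun E y' evs"
  have wV: "w \<in> V" "a \<in> V" "w \<noteq> a" using drun_V[OF wa] by auto
  have M'del: "drun (del {a} E) y' evs = ?M'"
    by (rule drun_del_unmatched[OF inj(2) a])
  obtain pre post where evs: "evs = pre @ Deadline w # post" and w: "w \<notin> matched (drun E y pre)"
    and aN: "a \<in> free_nbrs E w (matched (drun E y pre))"
    and amin: "a = arg_min_on y (free_nbrs E w (matched (drun E y pre)))"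
    by (rule drun_split[OF wa])
  have apre: "a \<notin> matched (drun E y pre)" using aN by (simp add: free_nbrs_def)
  have apre': "a \<notin> matched (drun E y' pre)"
    using a drun_mono[of E y' pre "Deadline w # post"] evs by (auto simp: matched_def)
  \<comment> \<open>Before this deadline \<open>a\<close> is unmatched in both runs, so both equal
    the run without \<open>a\<close>, which does not read the rank of \<open>a\<close>.\<close>
  have pre: "drun E y' pre = drun E y pre"
    using drun_del_unmatched[OF inj(1) apre] drun_del_unmatched[OF inj(2) apre']
      drun_del_upd[of a y y' "{a}" pre] eq by simp
  let ?N = "free_nbrs E w (matched (drun E y pre))" let ?r = "arg_min_on y' ?N"
  have wr: "(w, ?r) \<in> ?M'"
    using drun_deadline[OF evs, of y'] w aN unfolding pre by auto
  have ra: "?r \<noteq> a" using matchedI(2)[OF wr] a by auto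
  have rN: "?r \<in> ?N" using arg_min_free(1) aN by blast
  have "y a < y ?r"
    using arg_min_free_less[OF inj(1) rN] ra amin by metis
  then have yr: "y a < y' ?r" using eq[OF ra] by simp
  \<comment> \<open>If \<open>w\<close> were \<open>b\<close>, its pick at \<open>y\<close> would be
    \<open>a\<close>, whose rank is too small for the second alternative in the assumption on
    \<open>b\<close>.\<close>
  have wb: "w \<noteq> b"
  proof
    assume "w = b"
    then obtain p where "(w, p) \<in> ?M" "y' a < y p" using b matchedI(1)[OF wa] by auto
    then show False using drun_matching[OF wa, of w p] lt by auto
  qed
  have "a \<in> matched (drun (del {w} E) y' evs)"
  proof (rule ccontr)
    assume a': "a \<notin> matched (drun (del {w} E) y' evs)"
    interpret D: simple_graph V "del {w} E" by (rule del_simple_graph)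
    have dd: "del {a} (del {w} E) = del {w, a} E" by (auto simp: del_def)
    have X: "(c, p) \<in> ?M \<Longrightarrow> c \<in> {w, a} \<longleftrightarrow> p \<in> {w, a}" for c p
      using drun_matching[OF wa, of c p] by auto
    \<comment> \<open>An unmatched \<open>a\<close> may be deleted as well, after which its rank is
      irrelevant; at \<open>y\<close> the two deleted vertices form a matched pair, so the rest of
      that run survives.\<close>
    have "drun (del {w} E) y' evs = drun (del {w, a} E) y' evs"
      using D.drun_del_unmatched[OF inj(2) a'] dd by simp
    also have "\<dots> = drun (del {w, a} E) y evs"
      by (rule drun_del_upd[of a]) (use eq in auto)
    also have "\<dots> = {(c, p) \<in> ?M. c \<notin> {w, a}}"
      by (rule drun_del[OF inj(1) X])
    finally have M2: "drun (del {w} E) y' evs = {(c, p) \<in> ?M. c \<notin> {w, a}}" .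
    have abE: "{a, b} \<in> del {w} E" using ab wb wV by (auto simp: del_def)
    have bV: "b \<in> V" "a \<noteq> b" using edge_ends[OF ab] by auto
    \<comment> \<open>Both \<open>a\<close> and \<open>b\<close> are still present without
      \<open>w\<close>: an unmatched \<open>b\<close> contradicts maximality, and a pick of
      \<open>b\<close> with rank above \<open>y' a\<close> contradicts stability.\<close>
    from b show False
    proof
      assume "b \<notin> matched ?M"
      then have "b \<notin> matched (drun (del {w} E) y' evs)" unfolding M2 by (auto simp: matched_def)
      then show False using D.drun_maximal[OF abE dl[OF wV(2)]] a' by blast
    next
      assume "\<exists>p. (b, p) \<in> ?M \<and> y' a < y p"
      then obtain p where p: "(b, p) \<in> ?M" "y' a < y p" by blast
      then have "(b, p) \<in> drun (del {w} E) y' evs" unfolding M2 using wb bV by auto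
      moreover have "p \<noteq> a" using p lt by auto
      ultimately show False using D.drun_stable[OF _ abE a'] p eq by fastforce
    qed
  qed
  then have "victim evs y' w a"
    using a drun_edge[OF wa] by (simp add: victim_def)
  then show thesis using that wr yr wb by blast
qed

text \<open>If \<open>v\<close> at a smaller rank makes \<open>u\<close> lose, then \<open>u\<close> is the only difference between the two runs,
  so a free neighbour of \<open>u\<close> would have been free together with \<open>u\<close> before.\<close>

lemma no_free_nbr:
  assumes inj: "inj_on y V" "inj_on y' V"
    and dl: "\<And>c. c \<in> V \<Longrightarrow> Deadline c \<in> set evs"
    and eq: "\<And>c. c \<noteq> v \<Longrightarrow> y c = y' c"
    and u: "u \<notin> matched (drun E y evs)" "u \<in> matched (drun E y' evs)" "u \<noteq> v"
    and v: "v \<notin> matched (drun E y' evs)"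
    and x: "{u, x} \<in> E" "x \<notin> matched (drun E y' evs)"
  shows "x = v"
proof (rule ccontr)
  assume xv: "x \<noteq> v"
  have "drun (del {v} E) y evs = drun E y' evs"
    using drun_del_unmatched[OF inj(2) v] drun_del_upd[of v y y' "{v}" evs] eq by simp
  then have "close (matched (drun E y evs)) (insert v (matched (drun E y' evs)))"
    using drun_close[OF inj(1), of evs v] by simp
  then have "x \<notin> matched (drun E y evs)" using u x xv unfolding close_def by auto
  then show False using drun_maximal[OF x(1) dl] edge_ends[OF x(1)] u by blast
qed

subsection \<open>Gain sharing\<close>

definition pshare :: "real \<Rightarrow> real" where "pshare t = 9/20 + cap t / 5"
definition bonus :: "real \<Rightarrow> real" where "bonus t = cap t / 5"

text \<open>At most one summand is nonzero, because a run is a matching. Sums over the finite set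
  \<open>V\<close> allow exchanging summations in \<open>sum_gain\<close> and give measurability
  directly.\<close>

definition passive_gain where
  "passive_gain evs y a = (\<Sum>w\<in>V. if (w, a) \<in> drun E y evs then pshare (y a) else 0)"
definition active_gain where
  "active_gain evs y a = (\<Sum>p\<in>V. if (a, p) \<in> drun E y evs
     then 1 - pshare (y p) - (if \<exists>b. victim evs y a b then bonus (y p) else 0) else 0)"
definition received where
  "received evs y a = (\<Sum>w\<in>V. \<Sum>r\<in>V. if (w, r) \<in> drun E y evs \<and> victim evs y w a then bonus (y r) else 0)"
definition gain where
  "gain evs y a = passive_gain evs y a + active_gain evs y a + received evs y a"

lemma bonus_bounds: "0 \<le> bonus t" "bonus t \<le> 1/10"
  using cap_le[of t] cap_nonneg[of t] by (auto simp: bonus_def)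

lemma pshare_bounds: "9/20 \<le> pshare t" "pshare t \<le> 11/20"
  using cap_le[of t] cap_nonneg[of t] by (auto simp: pshare_def)

lemma victim_V: "victim evs y w a \<Longrightarrow> w \<in> V \<and> a \<in> V"
  using edge_ends by (auto simp: victim_def)

lemma passive_gain_eq:
  assumes "(w, a) \<in> drun E y evs"
  shows "passive_gain evs y a = pshare (y a)"
proof -
  have "(w', a) \<in> drun E y evs \<longleftrightarrow> w' = w" for w'
    using assms drun_matching[OF assms, of w' a] by auto
  then show ?thesis using drun_V[OF assms] finV by (simp add: passive_gain_def)
qed

lemma active_gain_eq:
  assumes "(a, p) \<in> drun E y evs"
  shows "active_gain evs y a = 1 - pshare (y p) - (if \<exists>b. victim evs y a b then bonus (y p) else 0)"
proof -
  have "(a, p') \<in> drun E y evs \<longleftrightarrow> p' = p" for p'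
    using assms drun_matching[OF assms, of a p'] by auto
  then show ?thesis using drun_V[OF assms] finV by (simp add: active_gain_def)
qed

lemma passive_gain_nonneg: "0 \<le> passive_gain evs y a"
  unfolding passive_gain_def
proof (rule sum_nonneg)
  fix w show "0 \<le> (if (w, a) \<in> drun E y evs then pshare (y a) else 0)"
    using pshare_bounds(1)[of "y a"] by auto
qed

lemma active_share_ge:
  "7/20 \<le> 1 - pshare (y p) - (if \<exists>b. victim evs y a b then bonus (y p) else 0)"
  using bonus_bounds[of "y p"] pshare_bounds[of "y p"] by auto

lemma active_gain_nonneg: "0 \<le> active_gain evs y a"
  unfolding active_gain_def
proof (rule sum_nonneg)
  fix p assume "p \<in> V"
  then show "0 \<le> (if (a, p) \<in> drun E y evs
     then 1 - pshare (y p) - (if \<exists>b. victim evs y a b then bonus (y p) else 0) else 0)"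
    using active_share_ge[of y p evs a] by auto
qed

text \<open>Stated for a set of paying pairs because a vertex may be the victim of several active
  vertices; \<open>edge_gain_neither\<close> uses two of them.\<close>

lemma received_ge_pair:
  assumes "K \<subseteq> {(w, r) \<in> drun E y evs. victim evs y w a}"
  shows "(\<Sum>(w, r)\<in>K. bonus (y r)) \<le> received evs y a"
proof -
  have KV: "K \<subseteq> V \<times> V" using assms drun_V by auto
  have "(\<Sum>(w, r)\<in>K. bonus (y r)) =
      (\<Sum>(w, r)\<in>K. if (w, r) \<in> drun E y evs \<and> victim evs y w a then bonus (y r) else 0)"
    by (rule sum.cong) (use assms in auto)
  also have "\<dots> \<le> (\<Sum>(w, r)\<in>V\<times>V. if (w, r) \<in> drun E y evs \<and> victim evs y w a then bonus (y r) else 0)"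
    by (rule sum_mono2) (use KV finV bonus_bounds in auto)
  also have "\<dots> = received evs y a"
    unfolding received_def by (rule sum.cartesian_product[symmetric])
  finally show ?thesis .
qed

lemma received_nonneg: "0 \<le> received evs y a"
  using received_ge_pair[of "{}" y evs a] by simp

lemma received_ge:
  assumes "(w, r) \<in> drun E y evs" "victim evs y w a"
  shows "bonus (y r) \<le> received evs y a"
  using received_ge_pair[of "{(w, r)}" y evs a] assms by simp

lemma gain_nonneg: "0 \<le> gain evs y a"
  using passive_gain_nonneg active_gain_nonneg received_nonneg by (simp add: gain_def)

lemma gain_passive: "(w, a) \<in> drun E y evs \<Longrightarrow> pshare (y a) \<le> gain evs y a"
  using active_gain_nonneg received_nonneg by (simp add: gain_def passive_gain_eq)

lemma gain_active_ge:
  assumes "(a, p) \<in> drun E y evs"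
  shows "1 - pshare (y p) - bonus (y p) \<le> gain evs y a"
proof -
  have "0 \<le> bonus (y p)" by (rule bonus_bounds)
  then have "1 - pshare (y p) - bonus (y p) \<le> active_gain evs y a"
    using active_gain_eq[OF assms] by auto
  then show ?thesis
    using passive_gain_nonneg[of evs y a] received_nonneg[of evs y a] by (simp add: gain_def)
qed

lemma gain_active_min: "(a, p) \<in> drun E y evs \<Longrightarrow> 7/20 \<le> gain evs y a"
  using gain_active_ge[of a p y evs] bonus_bounds(2)[of "y p"] pshare_bounds(2)[of "y p"] by linarith

text \<open>Each pair contributes 1: the two shares add up to 1 minus the bonus, and the bonus
  reappears at the victim. Uniqueness of the victim ensures that it is paid out just once.\<close>

lemma sum_gain:
  assumes inj: "inj_on y V"
  shows "(\<Sum>a\<in>V. gain evs y a) = real (card (drun E y evs))"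
proof -
  let ?M = "drun E y evs"
  have MV: "?M \<subseteq> V \<times> V" using drun_V by auto
  then have finM: "finite ?M" using finV by (meson finite_SigmaI finite_subset)
  have paid: "(\<Sum>a\<in>V. if victim evs y w a then bonus c else 0) =
      (if \<exists>b. victim evs y w b then bonus c else 0)" for w c
  proof (cases "\<exists>b. victim evs y w b")
    case True
    then obtain b where b: "victim evs y w b" by blast
    have "victim evs y w a \<longleftrightarrow> a = b" for a
      using victim_unique[OF inj _ b] b by blast
    then show ?thesis using b victim_V[OF b] finV True by simp
  qed simp
  have "(\<Sum>a\<in>V. received evs y a) =
      (\<Sum>a\<in>V. \<Sum>(w, r)\<in>V \<times> V. if (w, r) \<in> ?M \<and> victim evs y w a then bonus (y r) else 0)"
    by (simp add: received_def sum.cartesian_product)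
  also have "\<dots> = (\<Sum>(w, r)\<in>V \<times> V. \<Sum>a\<in>V. if (w, r) \<in> ?M \<and> victim evs y w a then bonus (y r) else 0)"
    by (subst sum.swap) (simp add: case_prod_unfold)
  also have "\<dots> = (\<Sum>(w, r)\<in>V \<times> V. if (w, r) \<in> ?M then (if \<exists>b. victim evs y w b then bonus (y r) else 0) else 0)"
  proof (rule sum.cong, simp, clarify)
    fix w r
    show "(\<Sum>a\<in>V. if (w, r) \<in> ?M \<and> victim evs y w a then bonus (y r) else 0) =
      (if (w, r) \<in> ?M then (if \<exists>b. victim evs y w b then bonus (y r) else 0) else 0)"
    proof (cases "(w, r) \<in> ?M")
      case True
      then show ?thesis by (simp only: True simp_thms if_True paid)
    next
      case False
      then show ?thesis by (simp only: False simp_thms if_False sum.neutral_const)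
    qed
  qed
  finally have rec: "(\<Sum>a\<in>V. received evs y a) =
    (\<Sum>(w, r)\<in>V \<times> V. if (w, r) \<in> ?M then (if \<exists>b. victim evs y w b then bonus (y r) else 0) else 0)" .
  have act: "(\<Sum>a\<in>V. active_gain evs y a) = (\<Sum>(w, r)\<in>V \<times> V. if (w, r) \<in> ?M
     then 1 - pshare (y r) - (if \<exists>b. victim evs y w b then bonus (y r) else 0) else 0)"
    by (simp add: active_gain_def sum.cartesian_product)
  have pas: "(\<Sum>a\<in>V. passive_gain evs y a) = (\<Sum>(w, r)\<in>V \<times> V. if (w, r) \<in> ?M then pshare (y r) else 0)"
    unfolding passive_gain_def by (subst sum.swap) (simp add: sum.cartesian_product)
  have "(\<Sum>a\<in>V. gain evs y a) =
      (\<Sum>a\<in>V. passive_gain evs y a) + (\<Sum>a\<in>V. active_gain evs y a) + (\<Sum>a\<in>V. received evs y a)"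
    by (simp only: gain_def sum.distrib)
  also have "\<dots> = (\<Sum>x\<in>V \<times> V. (case x of (w, r) \<Rightarrow> if (w, r) \<in> ?M then pshare (y r) else 0) +
      (case x of (w, r) \<Rightarrow> if (w, r) \<in> ?M
         then 1 - pshare (y r) - (if \<exists>b. victim evs y w b then bonus (y r) else 0) else 0) +
      (case x of (w, r) \<Rightarrow> if (w, r) \<in> ?M then (if \<exists>b. victim evs y w b then bonus (y r) else 0) else 0))"
    unfolding rec act pas by (simp only: sum.distrib)
  also have "\<dots> = (\<Sum>x\<in>V \<times> V. if x \<in> ?M then 1 else 0)"
  proof (rule sum.cong[OF refl])
    fix x assume "x \<in> V \<times> V"
    obtain w r where x: "x = (w, r)" by (cases x)
    show "(case x of (w, r) \<Rightarrow> if (w, r) \<in> ?M then pshare (y r) else 0) +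
      (case x of (w, r) \<Rightarrow> if (w, r) \<in> ?M
         then 1 - pshare (y r) - (if \<exists>b. victim evs y w b then bonus (y r) else 0) else 0) +
      (case x of (w, r) \<Rightarrow> if (w, r) \<in> ?M then (if \<exists>b. victim evs y w b then bonus (y r) else 0) else 0)
      = (if x \<in> ?M then 1 else 0)"
      unfolding x by (simp only: prod.case split: if_split) simp
  qed
  also have "\<dots> = real (card ?M)"
    using MV finM finV by (simp add: sum.If_cases Int_absorb1)
  finally show ?thesis .
qed

section \<open>Lower bounds for the gain of an edge\<close>

lemma edge_gain_both_passive:
  assumes "(c, a) \<in> drun E y evs" "(d, b) \<in> drun E y evs"
  shows "pshare (y a) + pshare (y b) \<le> gain evs y a + gain evs y b"
  using gain_passive[OF assms(1)] gain_passive[OF assms(2)] by simp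

lemma edge_gain_active:
  assumes "(c, a) \<in> drun E y evs" "(b, p) \<in> drun E y evs"
  shows "pshare (y a) + 1 - pshare (y p) - bonus (y p) \<le> gain evs y a + gain evs y b"
  using gain_passive[OF assms(1)] gain_active_ge[OF assms(2)] by simp

lemma edge_gain_unmatched:
  assumes "(c, a) \<in> drun E y evs"
  shows "pshare (y a) \<le> gain evs y a + gain evs y b"
  using gain_passive[OF assms(1)] gain_nonneg[of evs y b] by simp

text \<open>Raising the rank of \<open>b\<close> from \<open>t\<close> makes \<open>b\<close> a
  victim of \<open>w\<close>, its former partner. The new pick of \<open>w\<close> has rank above
  \<open>t\<close>, so by monotonicity the bonus is at least \<open>bonus t\<close>.\<close>

lemma edge_gain_compensated:
  assumes inj: "inj_on y V" "inj_on (y(b := t)) V"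
    and dl: "\<And>c. c \<in> V \<Longrightarrow> Deadline c \<in> set evs"
    and ab: "{a, b} \<in> E" and t: "t < y b"
    and a: "(c, a) \<in> drun E y evs" and b: "b \<notin> matched (drun E y evs)"
    and b': "(w, b) \<in> drun E (y(b := t)) evs" and a': "a \<notin> matched (drun E (y(b := t)) evs)"
  shows "pshare (y a) + bonus t \<le> gain evs y a + gain evs y b"
proof -
  obtain r where r: "(w, r) \<in> drun E y evs" "(y(b := t)) b < y r" "victim evs y w b"
    by (rule victim_of_rank_increase[OF inj(2,1) dl, of b w a])
      (use assms in \<open>auto simp: insert_commute\<close>)
  have "bonus t \<le> bonus (y r)" using r(2) cap_mono[of t "y r"] by (auto simp: bonus_def)
  then have "bonus t \<le> gain evs y b"
    using received_ge[OF r(1,3)] passive_gain_nonneg[of evs y b]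
      active_gain_nonneg[of evs y b] by (simp add: gain_def)
  then show ?thesis using gain_passive[OF a] by simp
qed

text \<open>No deadline of \<open>u\<close> or \<open>v\<close> precedes that of \<open>u\<close>,
  so neither has acted, and neither is ever passive. Both are thus free at this deadline, and
  \<open>u\<close> prefers some vertex to \<open>v\<close>.\<close>

lemma early_endpoint_active:
  assumes inj: "inj_on y V" and uv: "{u, v} \<in> E"
    and evs: "evs = pre @ Deadline u # post" "Deadline v \<notin> set pre"
    and npu: "\<And>c. (c, u) \<notin> drun E y evs" and npv: "\<And>c. (c, v) \<notin> drun E y evs"
    and un: "Deadline u \<notin> set pre"
  obtains p where "(u, p) \<in> drun E y evs" "y p < y v" "p \<noteq> v"
proof -
  have sub: "drun E y pre \<subseteq> drun E y evs" using drun_mono evs(1) by metis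
  have dl: "Deadline c \<in> set pre" if "(c, d) \<in> drun E y pre" for c d
    using drun_split[OF that] by (metis in_set_conv_decomp)
  have u: "u \<notin> matched (drun E y pre)"
  proof
    assume "u \<in> matched (drun E y pre)"
    then show False by (rule matchedE) (use npu un dl sub in blast)+
  qed
  have v: "v \<notin> matched (drun E y pre)"
  proof
    assume "v \<in> matched (drun E y pre)"
    then show False by (rule matchedE) (use npv evs(2) dl sub in blast)+
  qed
  let ?N = "free_nbrs E u (matched (drun E y pre))"
  have vN: "v \<in> ?N" using v uv by (auto simp: free_nbrs_def insert_commute)
  have up: "(u, arg_min_on y ?N) \<in> drun E y evs"
    using drun_deadline[OF evs(1) u] vN by blast
  moreover have ne: "v \<noteq> arg_min_on y ?N" using up npv by metis
  ultimately show thesis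
    using that arg_min_free_less[OF inj vN ne] by metis
qed

text \<open>Neither endpoint is passive: \<open>u\<close> keeps the active share, and \<open>v\<close> is compensated if it would
  have hurt \<open>u\<close> at a smaller rank.\<close>

lemma edge_gain_neither:
  assumes inj: "inj_on y V" "inj_on (y(v := t)) V"
    and dl: "\<And>c. c \<in> V \<Longrightarrow> Deadline c \<in> set evs"
    and uv: "{u, v} \<in> E" and t: "t < y v"
    and up: "(u, p) \<in> drun E y evs" "p \<noteq> v" and npv: "\<And>c. (c, v) \<notin> drun E y evs"
    and v': "(w, v) \<in> drun E (y(v := t)) evs"
  shows "u \<notin> matched (drun E (y(v := t)) evs) \<Longrightarrow>
      1 - pshare (y p) + bonus t \<le> gain evs y u + gain evs y v"
    and "(u, s) \<in> drun E (y(v := t)) evs \<Longrightarrow> y v < (y(v := t)) s \<Longrightarrow>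
      1 - pshare (y p) - bonus (y p) + bonus t \<le> gain evs y u + gain evs y v"
proof -
  let ?y = "y(v := t)"
  have pn: "0 \<le> bonus (y p)" by (rule bonus_bounds)
  have u_ge: "1 - pshare (y p) - bonus (y p) \<le> gain evs y u"
    by (rule gain_active_ge[OF up(1)])
  \<comment> \<open>An active \<open>v\<close> keeps at least 7/20, more than
    \<open>bonus (y p)\<close> and \<open>bonus t\<close> together, each being at most 1/10.\<close>
  have act: "1 - pshare (y p) + bonus t \<le> gain evs y u + gain evs y v" if "v \<in> matched (drun E y evs)"
  proof -
    have "\<exists>q. (v, q) \<in> drun E y evs" using that npv by (auto simp: matched_def)
    then obtain q where "(v, q) \<in> drun E y evs" by blast
    then have "7/20 \<le> gain evs y v" by (rule gain_active_min)
    then show ?thesis using u_ge bonus_bounds(2)[of "y p"] bonus_bounds(2)[of t] by linarith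
  qed
  have recv: "\<exists>r. (w, r) \<in> drun E y evs \<and> bonus t \<le> bonus (y r) \<and> victim evs y w v \<and> w \<noteq> u"
    if h: "v \<notin> matched (drun E y evs)"
      "u \<notin> matched (drun E ?y evs) \<or> (\<exists>s. (u, s) \<in> drun E ?y evs \<and> y v < ?y s)"
  proof -
    obtain r where r: "(w, r) \<in> drun E y evs" "?y v < y r" "victim evs y w v" "w \<noteq> u"
      by (rule victim_of_rank_increase[OF inj(2,1) dl, of v w u])
        (use h t v' uv in \<open>auto simp: insert_commute\<close>)
    moreover have "bonus t \<le> bonus (y r)" using r(2) cap_mono[of t "y r"] by (auto simp: bonus_def)
    ultimately show ?thesis by blast
  qed
  show "1 - pshare (y p) - bonus (y p) + bonus t \<le> gain evs y u + gain evs y v"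
    if us: "(u, s) \<in> drun E ?y evs" "y v < ?y s"
  proof (cases "v \<in> matched (drun E y evs)")
    case True
    then show ?thesis using act pn by simp
  next
    case False
    then obtain r where r: "(w, r) \<in> drun E y evs" "bonus t \<le> bonus (y r)" "victim evs y w v"
      using recv us by blast
    then have "bonus t \<le> gain evs y v"
      using received_ge[OF r(1,3)] passive_gain_nonneg[of evs y v]
        active_gain_nonneg[of evs y v] by (simp add: gain_def)
    then show ?thesis using u_ge by simp
  qed
  show "1 - pshare (y p) + bonus t \<le> gain evs y u + gain evs y v" if un: "u \<notin> matched (drun E ?y evs)"
  proof (cases "v \<in> matched (drun E y evs)")
    case True
    then show ?thesis using act by simp
  next
    case v: False
    then obtain r where r: "(w, r) \<in> drun E y evs" "bonus t \<le> bonus (y r)" "victim evs y w v" "w \<noteq> u"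
      using recv un by blast
    have gu: "1 - pshare (y p) - (if \<exists>b. victim evs y u b then bonus (y p) else 0) \<le> gain evs y u"
      using active_gain_eq[OF up(1)] passive_gain_nonneg[of evs y u] received_nonneg[of evs y u]
      by (simp add: gain_def)
    have gv: "received evs y v \<le> gain evs y v"
      using passive_gain_nonneg[of evs y v] active_gain_nonneg[of evs y v] by (simp add: gain_def)
    show ?thesis
    proof (cases "\<exists>b. victim evs y u b")
      case True
      then obtain b where b: "victim evs y u b" by blast
      \<comment> \<open>A bonus paid by \<open>u\<close> stays within the edge: its victim can only
        be \<open>v\<close>, which receives it in addition to the bonus from
        \<open>w\<close>.\<close>
      have "b = v"
        by (rule no_free_nbr[OF inj(2,1) dl, of v u b])
          (use un b v matchedI(1)[OF up(1)] edge_ends[OF uv] in \<open>auto simp: victim_def\<close>)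
      then have "bonus (y p) + bonus (y r) \<le> received evs y v"
        using received_ge_pair[of "{(u, p), (w, r)}" y evs v] b up r by simp
      then show ?thesis using gu gv r(2) True by simp
    next
      case False
      then show ?thesis using gu gv received_ge[OF r(1,3)] r(2) False by simp
    qed
  qed
qed

subsection \<open>Measurability in the ranks\<close>

text \<open>With ties, \<open>arg_min_on\<close> is a choice depending only on the set of
  minimisers. There are finitely many candidates \<open>K\<close> for that set, and each is
  described by finitely many comparisons.\<close>

lemma pred_arg_min_on:
  fixes f :: "'n \<Rightarrow> 'v \<Rightarrow> real"
  assumes f: "\<And>a. a \<in> S \<Longrightarrow> (\<lambda>n. f n a) \<in> borel_measurable N" and S: "finite S"
  shows "Measurable.pred N (\<lambda>n. arg_min_on (f n) S = (p :: 'v))"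
proof -
  let ?K = "\<lambda>n. {q \<in> S. \<forall>r\<in>S. \<not> f n r < (f n q :: real)}"
  have eq: "arg_min_on (f n) S = p \<longleftrightarrow>
      (\<exists>K\<in>Pow S. (SOME q. q \<in> K) = p \<and> (\<forall>q\<in>S. q \<in> K \<longleftrightarrow> (\<forall>r\<in>S. \<not> f n r < f n q)))" for n
  proof -
    have "arg_min_on (f n) S = (SOME q. q \<in> ?K n)"
      unfolding arg_min_on_def arg_min_def is_arg_min_def by (rule arg_cong[where f = Eps]) auto
    moreover have "(\<exists>K\<in>Pow S. (SOME q. q \<in> K) = p \<and> (\<forall>q\<in>S. q \<in> K \<longleftrightarrow> (\<forall>r\<in>S. \<not> f n r < f n q))) \<longleftrightarrow>
        (SOME q. q \<in> ?K n) = p"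
    proof
      assume "(SOME q. q \<in> ?K n) = p"
      then show "\<exists>K\<in>Pow S. (SOME q. q \<in> K) = p \<and> (\<forall>q\<in>S. q \<in> K \<longleftrightarrow> (\<forall>r\<in>S. \<not> f n r < f n q))"
        by (intro bexI[of _ "?K n"]) auto
    next
      assume "\<exists>K\<in>Pow S. (SOME q. q \<in> K) = p \<and> (\<forall>q\<in>S. q \<in> K \<longleftrightarrow> (\<forall>r\<in>S. \<not> f n r < f n q))"
      then obtain K where K: "K \<subseteq> S" "(SOME q. q \<in> K) = p" "\<forall>q\<in>S. q \<in> K \<longleftrightarrow> (\<forall>r\<in>S. \<not> f n r < f n q)"
        by auto
      have "K = ?K n" using K(1,3) by blast
      then show "(SOME q. q \<in> ?K n) = p" using K(2) by simp
    qed
    ultimately show ?thesis by simp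
  qed
  have lt: "Measurable.pred N (\<lambda>n. f n r < f n q)" if "r \<in> S" "q \<in> S" for r q
    using f[OF that(1)] f[OF that(2)] by measurable
  have "Measurable.pred N (\<lambda>n. \<exists>K\<in>Pow S. (SOME q. q \<in> K) = p \<and> (\<forall>q\<in>S. q \<in> K \<longleftrightarrow> (\<forall>r\<in>S. \<not> f n r < f n q)))"
    using S lt by (intro pred_intros_finite pred_intros_logic) auto
  then show ?thesis by (simp only: eq)
qed

lemma pred_drun_eq:
  assumes f: "\<And>a. a \<in> V \<Longrightarrow> (\<lambda>n. f n a) \<in> borel_measurable N"
  shows "Measurable.pred N (\<lambda>n. drun E (f n) evs = S)"
proof (induction evs arbitrary: S rule: rev_induct)
  case (snoc e evs)
  have VV: "drun E y evs \<in> Pow (V \<times> V)" for y using drun_V by auto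
  have eq: "drun E (f n) (evs @ [e]) = S \<longleftrightarrow>
      (\<exists>M\<in>Pow (V \<times> V). drun E (f n) evs = M \<and> dstep E (f n) e M = S)" for n
    using VV by auto
  have st: "Measurable.pred N (\<lambda>n. dstep E (f n) e M = S)" for M
  proof (cases e)
    case (Deadline c)
    let ?F = "free_nbrs E c (matched M)"
    show ?thesis
    proof (cases "c \<notin> matched M \<and> ?F \<noteq> {}")
      case True
      have "dstep E (f n) e M = S \<longleftrightarrow> (\<exists>p\<in>?F. arg_min_on (f n) ?F = p \<and> insert (c, p) M = S)" for n
        using True Deadline arg_min_free(1)[of c "matched M" "f n"] by (auto simp: Let_def)
      moreover have "Measurable.pred N (\<lambda>n. \<exists>p\<in>?F. arg_min_on (f n) ?F = p \<and> insert (c, p) M = S)"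
        by (intro pred_intros_finite pred_intros_logic fin_free_nbrs pred_arg_min_on)
          (use f free_nbrs_sub in auto)
      ultimately show ?thesis by (simp only:)
    next
      case False
      then have "dstep E (f n) e M = M" for n using Deadline by (auto simp: Let_def)
      then show ?thesis by simp
    qed
  qed simp
  have "Measurable.pred N (\<lambda>n. \<exists>M\<in>Pow (V \<times> V). drun E (f n) evs = M \<and> dstep E (f n) e M = S)"
    using finV snoc st by (intro pred_intros_finite pred_intros_logic) auto
  then show ?case by (simp only: eq)
qed simp

lemma pred_drun:
  assumes f: "\<And>a. a \<in> V \<Longrightarrow> (\<lambda>n. f n a) \<in> borel_measurable N"
  shows "Measurable.pred N (\<lambda>n. P (drun E (f n) evs))"
proof -
  have "P (drun E (f n) evs) \<longleftrightarrow> (\<exists>M\<in>Pow (V \<times> V). drun E (f n) evs = M \<and> P M)" for n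
    using drun_V[of _ _ "f n" evs] by auto
  moreover have "Measurable.pred N (\<lambda>n. \<exists>M\<in>Pow (V \<times> V). drun E (f n) evs = M \<and> P M)"
    using finV pred_drun_eq[OF f] by (intro pred_intros_finite pred_intros_logic) auto
  ultimately show ?thesis by (simp only:)
qed

lemma pred_victim:
  assumes f: "\<And>a. a \<in> V \<Longrightarrow> (\<lambda>n. f n a) \<in> borel_measurable N"
  shows "Measurable.pred N (\<lambda>n. victim evs (f n) w a)"
proof -
  interpret D: simple_graph V "del {w} E" by (rule del_simple_graph)
  show ?thesis
    unfolding victim_def
    by (intro pred_intros_logic pred_drun[where P = "\<lambda>M. a \<in> matched M", OF f]
        D.pred_drun[where P = "\<lambda>M. a \<in> matched M", OF f]) simp_all
qed

lemma cap_measurable [measurable]: "cap \<in> borel_measurable borel"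
  unfolding cap_def[abs_def] by measurable

lemma gain_measurable:
  assumes f: "\<And>a. a \<in> V \<Longrightarrow> (\<lambda>n. f n a) \<in> borel_measurable N" and a: "a \<in> V"
  shows "(\<lambda>n. gain evs (f n) a) \<in> borel_measurable N"
proof -
  have d [measurable]: "Measurable.pred N (\<lambda>n. (b, p) \<in> drun E (f n) evs)" for b p
    by (rule pred_drun[where P = "\<lambda>M. (b, p) \<in> M", OF f])
  have v [measurable]: "Measurable.pred N (\<lambda>n. victim evs (f n) b p)" for b p
    by (rule pred_victim[OF f])
  have ve: "(\<exists>b. victim evs (f n) a b) \<longleftrightarrow> (\<exists>b\<in>V. victim evs (f n) a b)" for n
    using victim_V by auto
  have [measurable]: "Measurable.pred N (\<lambda>n. \<exists>b. victim evs (f n) a b)"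
    unfolding ve by (intro pred_intros_finite finV v)
  have [measurable]: "(\<lambda>n. pshare (f n b)) \<in> borel_measurable N" "(\<lambda>n. bonus (f n b)) \<in> borel_measurable N"
    if "b \<in> V" for b
    unfolding pshare_def bonus_def using f[OF that] by measurable
  show ?thesis
    unfolding gain_def passive_gain_def active_gain_def received_def
    using a by measurable
qed

lemma gain_bound: "gain evs y a \<le> 3 * (1 + real (card V))\<^sup>2"
proof -
  have sum_le: "(\<Sum>b\<in>V. h b) \<le> real (card V)" if "\<And>b. h b \<le> 1" for h :: "'v \<Rightarrow> real"
    using sum_bounded_above[of V h 1] that by simp
  have p: "passive_gain evs y a \<le> real (card V)"
    unfolding passive_gain_def
  proof (rule sum_le)
    fix w show "(if (w, a) \<in> drun E y evs then pshare (y a) else 0) \<le> 1"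
      using pshare_bounds(2)[of "y a"] by auto
  qed
  have c: "active_gain evs y a \<le> real (card V)"
    unfolding active_gain_def
  proof (rule sum_le)
    fix p show "(if (a, p) \<in> drun E y evs
     then 1 - pshare (y p) - (if \<exists>b. victim evs y a b then bonus (y p) else 0) else 0) \<le> 1"
      using pshare_bounds(1)[of "y p"] bonus_bounds(1)[of "y p"] by auto
  qed
  have "received evs y a \<le> (\<Sum>w\<in>V. real (card V))"
    unfolding received_def
  proof (intro sum_mono sum_le)
    fix w r show "(if (w, r) \<in> drun E y evs \<and> victim evs y w a then bonus (y r) else 0) \<le> 1"
      using bonus_bounds(2)[of "y r"] by auto
  qed
  also have "\<dots> = (real (card V))\<^sup>2" by (simp add: power2_eq_square)
  finally have r: "received evs y a \<le> (real (card V))\<^sup>2" .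
  have "gain evs y a \<le> real (card V) + real (card V) + (real (card V))\<^sup>2"
    using p c r by (simp add: gain_def)
  also have "\<dots> \<le> 3 * (1 + real (card V))\<^sup>2" by (simp add: power2_sum)
  finally show ?thesis .
qed

text \<open>Only comparisons of ranks enter a run. This is what makes runs locally constant in
  generic ranks.\<close>

lemma drun_order_cong:
  assumes "\<And>a b. a \<in> V \<Longrightarrow> b \<in> V \<Longrightarrow> y a < y b \<longleftrightarrow> y' a < (y' b :: real)"
  shows "drun E y evs = drun E y' evs"
proof (induction evs rule: rev_induct)
  case (snoc e evs)
  have "arg_min_on y (free_nbrs E c U) = arg_min_on y' (free_nbrs E c U)" for c U
  proof -
    have "is_arg_min y (\<lambda>x. x \<in> free_nbrs E c U) q = is_arg_min y' (\<lambda>x. x \<in> free_nbrs E c U) q" for q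
      unfolding is_arg_min_def using assms free_nbrs_sub[of c U] by (metis Diff_iff subsetD)
    then have "is_arg_min y (\<lambda>x. x \<in> free_nbrs E c U) = is_arg_min y' (\<lambda>x. x \<in> free_nbrs E c U)" by blast
    then show ?thesis unfolding arg_min_on_def arg_min_def by simp
  qed
  then show ?case using snoc by (cases e) (auto simp: Let_def)
qed simp

end

subsection \<open>One edge with the other ranks fixed\<close>

text \<open>The end with the earlier deadline is called \<open>u\<close>; \<open>z\<close> supplies
  the ranks of all vertices except the two ends.\<close>

locale fixed_ranks = simple_graph +
  fixes evs :: "'a event list" and z :: "'a \<Rightarrow> real" and u v :: 'a and pre post
  assumes dl: "\<And>c. c \<in> V \<Longrightarrow> Deadline c \<in> set evs"
    and uv: "{u, v} \<in> E" and evs: "evs = pre @ Deadline u # post"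
    and early: "Deadline v \<notin> set pre" "Deadline u \<notin> set pre"
    and inj_z: "inj_on z (V - {u, v})"
begin

definition rk :: "real \<Rightarrow> real \<Rightarrow> 'a \<Rightarrow> real" where "rk x y = z(u := x, v := y)"
definition run where "run x y = drun E (rk x y) evs"
definition pu where "pu x y \<longleftrightarrow> (\<exists>c. (c, u) \<in> run x y)"
definition pv where "pv x y \<longleftrightarrow> (\<exists>c. (c, v) \<in> run x y)"
definition others where "others = z ` (V - {u, v})"
definition gen where
  "gen x y \<longleftrightarrow> 0 < x \<and> x < 1 \<and> 0 < y \<and> y < 1 \<and> x \<notin> others \<and> y \<notin> others \<and> x \<noteq> (y :: real)"
definition cu where "cu x y \<longleftrightarrow> gen x y \<and> pv x y \<and> u \<notin> matched (run x y)"
definition bu where "bu x y \<longleftrightarrow> gen x y \<and> pu x y \<and> v \<notin> matched (run x y)"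
text \<open>The value 0 is a default for runs in which \<open>u\<close> picks nobody; the estimates
  of \<open>w\<close> read \<open>th\<close> only where \<open>u\<close> is active.\<close>

definition th where
  "th x y = (if \<exists>p. (u, p) \<in> run x y then rk x y (THE p. (u, p) \<in> run x y) else 0)"
definition w where "w x y = 5 * (gain evs (rk x y) u + gain evs (rk x y) v - 9/20)"

lemma uvV: "u \<in> V" "v \<in> V" "u \<noteq> v"
  using edge_ends[OF uv] by auto

lemma rk_simps [simp]: "rk x y u = x" "rk x y v = y" "c \<noteq> u \<Longrightarrow> c \<noteq> v \<Longrightarrow> rk x y c = z c"
  "(rk x y)(v := y') = rk x y'" "(rk x y)(u := x') = rk x' y"
  using uvV by (auto simp: rk_def fun_eq_iff)

lemma inj_rk:
  assumes "gen x y"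
  shows "inj_on (rk x y) V"
proof (rule inj_onI)
  fix a b assume ab: "a \<in> V" "b \<in> V" "rk x y a = rk x y b"
  have o: "z c \<in> others" if "c \<in> V" "c \<noteq> u" "c \<noteq> v" for c using that by (auto simp: others_def)
  show "a = b"
    using ab assms o[of a] o[of b] inj_onD[OF inj_z, of a b] uvV(3)
    by (cases "a = u"; cases "a = v"; cases "b = u"; cases "b = v") (auto simp: gen_def)
qed

lemma th_eq: "(u, p) \<in> run x y \<Longrightarrow> th x y = rk x y p"
proof -
  assume p: "(u, p) \<in> run x y"
  have "(THE p. (u, p) \<in> run x y) = p"
  proof (rule the_equality)
    fix q assume "(u, q) \<in> run x y"
    then show "q = p" using drun_matching[of u p "rk x y" evs u q] p by (auto simp: run_def)
  qed (rule p)
  then show ?thesis using p by (auto simp: th_def)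
qed

lemma u_active: "\<not> pu x y \<Longrightarrow> u \<in> matched (run x y) \<Longrightarrow> \<exists>p. (u, p) \<in> run x y"
  and v_active: "\<not> pv x y \<Longrightarrow> v \<in> matched (run x y) \<Longrightarrow> \<exists>p. (v, p) \<in> run x y"
  by (auto simp: pu_def pv_def matched_def)

lemma neither:
  assumes "gen x y" "\<not> pu x y" "\<not> pv x y"
  obtains p where "(u, p) \<in> run x y" "th x y = rk x y p" "rk x y p < y" "p \<noteq> v"
proof -
  obtain p where p: "(u, p) \<in> drun E (rk x y) evs" "rk x y p < rk x y v" "p \<noteq> v"
    by (rule early_endpoint_active[OF inj_rk[OF assms(1)] uv evs early(1) _ _ early(2)])
      (use assms in \<open>auto simp: pu_def pv_def run_def\<close>)
  then show thesis using that[of p] th_eq[of p x y] by (simp add: run_def)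
qed

lemma raise_v:
  assumes "gen x y" "gen x y'" "y < y'" "\<not> pv x y"
  shows "run x y' = run x y"
  unfolding run_def
  by (rule drun_raise[OF inj_rk[OF assms(1)] inj_rk[OF assms(2)], of v])
    (use assms in \<open>auto simp: pv_def run_def rk_def\<close>)

lemma raise_u:
  assumes "gen x y" "gen x' y" "x < x'" "\<not> pu x y"
  shows "run x' y = run x y"
  unfolding run_def
  by (rule drun_raise[OF inj_rk[OF assms(1)] inj_rk[OF assms(2)], of u])
    (use assms uvV in \<open>auto simp: pu_def run_def rk_def\<close>)

text \<open>Ranks that move by less than half of the smallest gap keep their order and stay inside
  (0,1), and a run depends only on that order.\<close>

lemma locally_const:
  assumes "gen x y"
  shows "\<exists>e>0. \<forall>x' y'. \<bar>x' - x\<bar> < e \<longrightarrow> \<bar>y' - y\<bar> < e \<longrightarrow> gen x' y' \<and> run x' y' = run x y"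
proof -
  define D where "D = {x, 1 - x, y, 1 - y, \<bar>x - y\<bar>} \<union> (\<lambda>r. \<bar>x - r\<bar>) ` others \<union> (\<lambda>r. \<bar>y - r\<bar>) ` others"
  have fin: "finite D" "D \<noteq> {}" using finV by (auto simp: D_def others_def)
  have pos: "0 < d" if "d \<in> D" for d using that assms by (auto simp: D_def gen_def)
  define e where "e = Min D / 2"
  have e0: "0 < e" using Min_in[OF fin] pos by (simp add: e_def)
  have e: "2 * e \<le> d" if "d \<in> D" for d using Min_le[OF fin(1) that] by (simp add: e_def)
  have ex: "2 * e \<le> x" "2 * e \<le> 1 - x" "2 * e \<le> y" "2 * e \<le> 1 - y" "2 * e \<le> \<bar>x - y\<bar>"
    using e by (auto simp: D_def)
  have eo: "2 * e \<le> \<bar>x - r\<bar>" "2 * e \<le> \<bar>y - r\<bar>" if "r \<in> others" for r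
    using e that by (auto simp: D_def)
  show ?thesis
  proof (intro exI[of _ e] conjI allI impI e0)
    fix x' y' assume d: "\<bar>x' - x\<bar> < e" "\<bar>y' - y\<bar> < e"
    have "x' \<notin> others" "y' \<notin> others" using eo(1)[of x'] eo(2)[of y'] d e0 by auto
    moreover have "x' \<noteq> y'" using ex(5) d by auto
    ultimately show "gen x' y'" using ex d e0 by (auto simp: gen_def)
    show "run x' y' = run x y"
      unfolding run_def
    proof (rule drun_order_cong)
      fix a b assume ab: "a \<in> V" "b \<in> V"
      have 1: "(x' < r \<longleftrightarrow> x < r) \<and> (r < x' \<longleftrightarrow> r < x) \<and> (y' < r \<longleftrightarrow> y < r) \<and> (r < y' \<longleftrightarrow> r < y)" if "r \<in> others" for r
        using eo[OF that] d by (auto simp: abs_if split: if_splits)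
      have 2: "(x' < y' \<longleftrightarrow> x < y) \<and> (y' < x' \<longleftrightarrow> y < x)" using ex(5) d by (auto simp: abs_if split: if_splits)
      have 3: "(x' < z c \<longleftrightarrow> x < z c) \<and> (z c < x' \<longleftrightarrow> z c < x) \<and> (y' < z c \<longleftrightarrow> y < z c) \<and> (z c < y' \<longleftrightarrow> z c < y)"
        if "c \<in> V" "c \<noteq> u" "c \<noteq> v" for c
        using 1[of "z c"] that by (auto simp: others_def)
      show "rk x' y' a < rk x' y' b \<longleftrightarrow> rk x y a < rk x y b"
      proof (cases "a \<in> {u, v}")
        case a: True
        show ?thesis
        proof (cases "b \<in> {u, v}")
          case True
          then show ?thesis using a 2 by auto
        next
          case False
          then show ?thesis using a 3[OF ab(2)] by auto
        qed
      next
        case a: False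
        show ?thesis
        proof (cases "b \<in> {u, v}")
          case True
          then show ?thesis using a 3[OF ab(1)] by auto
        next
          case False
          then show ?thesis using a by simp
        qed
      qed
    qed
  qed
qed

lemma rk_measurable: "(\<lambda>p. rk (fst p) (snd p) a) \<in> borel_measurable (borel \<Otimes>\<^sub>M borel)"
  using uvV(3) by (cases "a = u"; cases "a = v") (simp_all add: rk_def)

lemma run_measurable: "Measurable.pred (borel \<Otimes>\<^sub>M borel) (\<lambda>p. P (run (fst p) (snd p)))"
  unfolding run_def by (rule pred_drun) (rule rk_measurable)

lemma gen_measurable: "Measurable.pred (borel \<Otimes>\<^sub>M borel) (\<lambda>p. gen (fst p) (snd p))"
proof -
  have "finite others" using finV by (simp add: others_def)
  then have "others \<in> sets borel" by (intro borel_closed finite_imp_closed)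
  then show ?thesis unfolding gen_def by measurable
qed

text \<open>The numbers come from rescaling by \<open>5 * (_ - 9/20)\<close>: two passive shares
  give 9/4, a passive and an active share 11/4, an active share alone 1/2, each up to
  \<open>cap\<close> terms. The bound on \<open>w\<close> is crude and serves integrability.\<close>

sublocale square: rank_square w th pu pv cu bu others "30 * (1 + real (card V))\<^sup>2 + 9/4" gen "\<lambda>x y. gen x y \<and> \<not> pu x y \<and> \<not> pv x y"
proof unfold_locales
  show "finite others" using finV by (simp add: others_def)
  show "(\<lambda>p. w (fst p) (snd p)) \<in> borel_measurable (borel \<Otimes>\<^sub>M borel)"
    unfolding w_def using gain_measurable[OF rk_measurable uvV(1), of evs] gain_measurable[OF rk_measurable uvV(2), of evs]
    by measurable
  show "Measurable.pred (borel \<Otimes>\<^sub>M borel) (\<lambda>p. cu (fst p) (snd p))"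
    unfolding cu_def pv_def by (intro pred_intros_logic gen_measurable run_measurable)
  show "Measurable.pred (borel \<Otimes>\<^sub>M borel) (\<lambda>p. bu (fst p) (snd p))"
    unfolding bu_def pu_def by (intro pred_intros_logic gen_measurable run_measurable)
  show "Measurable.pred (borel \<Otimes>\<^sub>M borel) (\<lambda>p. gen (fst p) (snd p) \<and> \<not> pu (fst p) (snd p) \<and> \<not> pv (fst p) (snd p))"
    unfolding pu_def pv_def by (intro pred_intros_logic gen_measurable run_measurable)
next
  fix x y
  show "gen x y \<longleftrightarrow> 0 < x \<and> x < 1 \<and> 0 < y \<and> y < 1 \<and> x \<notin> others \<and> y \<notin> others \<and> x \<noteq> y"
    by (rule gen_def)
  show "\<bar>w x y\<bar> \<le> 30 * (1 + real (card V))\<^sup>2 + 9/4"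
    using gain_bound[of evs "rk x y" u] gain_bound[of evs "rk x y" v]
      gain_nonneg[of evs "rk x y" u] gain_nonneg[of evs "rk x y" v]
    unfolding w_def by (simp add: abs_le_iff)
  show "gen x y \<and> pv x y \<and> \<not> pu x y" if hyp: "cu x y"
    using hyp by (auto simp: cu_def pu_def matched_def image_iff)
  show "gen x y \<and> pu x y \<and> \<not> pv x y" if hyp: "bu x y"
    using hyp by (auto simp: bu_def pv_def matched_def image_iff)
  show "9/4 + cap y \<le> w x y" if hyp: "gen x y" "pu x y" "pv x y"
  proof -
    obtain c d where "(c, u) \<in> drun E (rk x y) evs" "(d, v) \<in> drun E (rk x y) evs"
      using hyp by (auto simp: pu_def pv_def run_def)
    from edge_gain_both_passive[OF this] show ?thesis
      using cap_nonneg[of x] by (simp add: w_def pshare_def)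
  qed
  show "7/4 \<le> w x y" if hyp: "gen x y" "pu x y" "\<not> pv x y" "\<not> bu x y"
  proof -
    obtain c p where "(c, u) \<in> drun E (rk x y) evs" "(v, p) \<in> drun E (rk x y) evs"
      using hyp v_active[of x y] by (auto simp: pu_def run_def bu_def)
    from edge_gain_active[OF this] show ?thesis
      using cap_nonneg[of x] cap_le[of "rk x y p"] by (simp add: w_def pshare_def bonus_def)
  qed
  show "cap x \<le> w x y" if hyp: "bu x y"
  proof -
    obtain c where "(c, u) \<in> drun E (rk x y) evs" using hyp by (auto simp: bu_def pu_def run_def)
    from edge_gain_unmatched[OF this, of v] show ?thesis by (simp add: w_def pshare_def)
  qed
  show "cap y \<le> w x y" if hyp: "cu x y"
  proof -
    obtain c where "(c, v) \<in> drun E (rk x y) evs" using hyp by (auto simp: cu_def pv_def run_def)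
    from edge_gain_unmatched[OF this, of u] show ?thesis by (simp add: w_def pshare_def)
  qed
  show "11/4 + cap y - 2 * cap (th x y) \<le> w x y" if hyp: "gen x y" "\<not> pu x y" "pv x y" "\<not> cu x y"
  proof -
    obtain c p where "(c, v) \<in> drun E (rk x y) evs" "(u, p) \<in> drun E (rk x y) evs"
      using hyp u_active[of x y] by (auto simp: pv_def run_def cu_def)
    from edge_gain_active[OF this] show ?thesis
      using th_eq[of p x y] \<open>(u, p) \<in> _\<close> by (simp add: w_def pshare_def bonus_def run_def)
  qed
  show "cap x + cap y' \<le> w x y" if hyp: "bu x y" "cu x y'" "y' < y" for y'
  proof -
    have g: "gen x y" "gen x y'" using hyp by (auto simp: bu_def cu_def)
    obtain c d where "(c, u) \<in> drun E (rk x y) evs" "(d, v) \<in> drun E (rk x y') evs"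
      using hyp by (auto simp: bu_def pu_def cu_def pv_def run_def)
    then show ?thesis
      using edge_gain_compensated[of "rk x y" v y' evs u c d] inj_rk g dl uv hyp
      by (simp add: w_def pshare_def bonus_def bu_def cu_def run_def)
  qed
  show "cap y + cap x' \<le> w x y" if hyp: "cu x y" "bu x' y" "x' < x" for x'
  proof -
    have g: "gen x y" "gen x' y" using hyp by (auto simp: bu_def cu_def)
    obtain c d where "(c, v) \<in> drun E (rk x y) evs" "(d, u) \<in> drun E (rk x' y) evs"
      using hyp by (auto simp: bu_def pu_def cu_def pv_def run_def)
    then show ?thesis
      using edge_gain_compensated[of "rk x y" u x' evs v c d] inj_rk g dl uv hyp
      by (simp add: w_def pshare_def bonus_def bu_def cu_def run_def insert_commute)
  qed
  show "th x y < y" if hyp: "gen x y \<and> \<not> pu x y \<and> \<not> pv x y"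
    using neither hyp by metis
  show "1/2 - 2 * cap (th x y) \<le> w x y" if hyp: "gen x y \<and> \<not> pu x y \<and> \<not> pv x y"
  proof -
    obtain p where p: "(u, p) \<in> run x y" "th x y = rk x y p" using neither hyp by metis
    then show ?thesis
      using gain_active_ge[of u p "rk x y" evs] gain_nonneg[of evs "rk x y" v]
      by (simp add: w_def pshare_def bonus_def run_def)
  qed
  show "1/2 - cap (th x y) + cap y' \<le> w x y"
    if hyp: "gen x y \<and> \<not> pu x y \<and> \<not> pv x y" "cu x y'" "y' < y" for y'
  proof -
    have g: "gen x y" "gen x y'" using hyp by (auto simp: cu_def)
    obtain p where p: "(u, p) \<in> run x y" "th x y = rk x y p" "p \<noteq> v" using neither hyp by metis
    obtain d where d: "(d, v) \<in> drun E (rk x y') evs" using hyp by (auto simp: cu_def pv_def run_def)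
    show ?thesis
      using edge_gain_neither(1)[of "rk x y" v y' evs u p d] inj_rk g dl uv hyp p d
      by (simp add: w_def pshare_def bonus_def cu_def pv_def run_def)
  qed
  show "1/2 - 2 * cap (th x y) + cap y' \<le> w x y"
    if hyp: "gen x y \<and> \<not> pu x y \<and> \<not> pv x y" "gen x y'" "pv x y'" "\<not> pu x y'" "\<not> cu x y'" "y' < y" "y < th x y'" for y'
  proof -
    obtain p where p: "(u, p) \<in> run x y" "th x y = rk x y p" "p \<noteq> v" using neither hyp by metis
    obtain d where d: "(d, v) \<in> drun E (rk x y') evs" using hyp by (auto simp: pv_def run_def)
    obtain s where s: "(u, s) \<in> run x y'" using u_active[of x y'] hyp by (auto simp: cu_def)
    show ?thesis
      using edge_gain_neither(2)[of "rk x y" v y' evs u p d s] inj_rk hyp dl uv p d s th_eq[OF s]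
      by (simp add: w_def pshare_def bonus_def pv_def run_def)
  qed
  show "\<not> pv x y' \<and> (pu x y' \<longleftrightarrow> pu x y) \<and> th x y' = th x y"
    if hyp: "gen x y" "gen x y'" "y < y'" "\<not> pv x y" for y'
  proof -
    have r: "run x y' = run x y" by (rule raise_v[OF hyp])
    have "th x y' = th x y"
    proof (cases "\<exists>p. (u, p) \<in> run x y")
      case True
      then obtain p where p: "(u, p) \<in> run x y" by blast
      have "p \<noteq> v" using p hyp(4) by (auto simp: pv_def)
      then have "rk x y' p = rk x y p" by (auto simp: rk_def)
      then show ?thesis using th_eq[OF p] th_eq[of p x y'] p r by simp
    next
      case False
      then show ?thesis using r by (simp add: th_def)
    qed
    then show ?thesis using r hyp by (simp add: pv_def pu_def)
  qed
  show "\<not> pu x' y" if hyp: "gen x y" "gen x' y" "x < x'" "\<not> pu x y" for x'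
    using raise_u[OF hyp] hyp by (simp add: pu_def)
  show "\<exists>e>0. \<forall>x' y'. \<bar>x' - x\<bar> < e \<longrightarrow> \<bar>y' - y\<bar> < e \<longrightarrow> (cu x' y' \<longleftrightarrow> cu x y) \<and> (bu x' y' \<longleftrightarrow> bu x y) \<and>
      ((gen x' y' \<and> \<not> pu x' y' \<and> \<not> pv x' y') \<longleftrightarrow> (gen x y \<and> \<not> pu x y \<and> \<not> pv x y))" if hyp: "gen x y"
  proof -
    obtain e where e: "e > 0"
      "\<And>x' y'. \<bar>x' - x\<bar> < e \<Longrightarrow> \<bar>y' - y\<bar> < e \<Longrightarrow> gen x' y' \<and> run x' y' = run x y"
      using locally_const[OF hyp] by blast
    show ?thesis
    proof (intro exI[of _ e] conjI[OF e(1)] allI impI)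
      fix x' y' assume "\<bar>x' - x\<bar> < e" "\<bar>y' - y\<bar> < e"
      then have "gen x' y' \<and> run x' y' = run x y" by (rule e(2))
      then have g: "gen x' y'" and r: "run x' y' = run x y" by simp_all
      show "(cu x' y' \<longleftrightarrow> cu x y) \<and> (bu x' y' \<longleftrightarrow> bu x y) \<and>
          ((gen x' y' \<and> \<not> pu x' y' \<and> \<not> pv x' y') \<longleftrightarrow> (gen x y \<and> \<not> pu x y \<and> \<not> pv x y))"
        unfolding cu_def bu_def pu_def pv_def using hyp g r by simp
    qed
  qed
qed simp

lemma integral_edge_gain:
  "5211/10000 \<le> (\<integral>x. \<integral>y. gain evs (z(u := x, v := y)) u + gain evs (z(u := x, v := y)) v \<partial>unif \<partial>unif)"
proof -
  have eq: "gain evs (z(u := x, v := y)) u + gain evs (z(u := x, v := y)) v = w x y / 5 + 9/20" for x y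
    by (simp add: w_def rk_def field_simps)
  have "(\<integral>y. w x y / 5 + 9/20 \<partial>unif) = (\<integral>y. w x y \<partial>unif) / 5 + 9/20" for x
    using square.integrable_w[of x]
    by (subst Bochner_Integration.integral_add) (auto simp: unif.prob_space[simplified])
  then have "(\<integral>x. \<integral>y. gain evs (z(u := x, v := y)) u + gain evs (z(u := x, v := y)) v \<partial>unif \<partial>unif) =
      (\<integral>x. (\<integral>y. w x y \<partial>unif) / 5 + 9/20 \<partial>unif)"
    by (simp only: eq)
  also have "\<dots> = (\<integral>x. \<integral>y. w x y \<partial>unif \<partial>unif) / 5 + 9/20"
    using square.integrable_w_fst
    by (subst Bochner_Integration.integral_add) (auto simp: unif.prob_space[simplified])
  finally show ?thesis using square.square_bound by (simp add: power2_eq_square)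
qed

end

subsection \<open>All ranks random\<close>

interpretation unif_prod: product_sigma_finite "\<lambda>_::'v. unif" ..

lemma measurable_component_unif:
  assumes "a \<in> S"
  shows "(\<lambda>y. y a) \<in> borel_measurable (PiM S (\<lambda>_. unif))"
proof -
  have "(\<lambda>y. y a) \<in> PiM S (\<lambda>_. unif) \<rightarrow>\<^sub>M unif"
    by (rule measurable_component_singleton[OF assms])
  also have "\<dots> = borel_measurable (PiM S (\<lambda>_. unif))"
    by (rule measurable_cong_sets) auto
  finally show ?thesis .
qed

text \<open>Integrate over the rank of \<open>a\<close> first: with the other ranks fixed, a
  collision is a single point.\<close>

lemma AE_unif_PiM_neq:
  assumes fin: "finite V" and ab: "a \<in> V" "b \<in> V" "a \<noteq> b"
  shows "AE y in PiM V (\<lambda>_. unif). y a \<noteq> y b"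
proof -
  define W where "W = V - {a}"
  have V: "V = insert a W" "finite W" "a \<notin> W" "b \<in> W" using fin ab by (auto simp: W_def)
  let ?N = "{y \<in> space (PiM V (\<lambda>_. unif)). y a = y b}"
  have N: "?N \<in> sets (PiM V (\<lambda>_. unif))"
    using ab by measurable
  have "emeasure (PiM V (\<lambda>_. unif)) ?N = (\<integral>\<^sup>+y. indicator ?N y \<partial>PiM V (\<lambda>_. unif))"
    using N by simp
  also have "\<dots> = (\<integral>\<^sup>+y. (\<integral>\<^sup>+x. indicator ?N (y(a := x)) \<partial>unif) \<partial>PiM W (\<lambda>_. unif))"
    using N unfolding V(1) by (intro unif_prod.product_nn_integral_insert V) auto
  also have "\<dots> = (\<integral>\<^sup>+y. 0 \<partial>PiM W (\<lambda>_. unif))"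
  proof (rule nn_integral_cong)
    fix y :: "'a \<Rightarrow> real"
    have "(\<integral>\<^sup>+x. indicator ?N (y(a := x)) \<partial>unif) = (\<integral>\<^sup>+x. 0 \<partial>unif)"
      by (rule nn_integral_cong_AE) (use AE_unif_neq[of "y b"] ab in \<open>auto simp: indicator_def\<close>)
    then show "(\<integral>\<^sup>+x. indicator ?N (y(a := x)) \<partial>unif) = 0" by simp
  qed
  finally have "emeasure (PiM V (\<lambda>_. unif)) ?N = 0" by simp
  then show ?thesis using N by (subst AE_iff_measurable) auto
qed

lemma AE_unif_PiM_inj:
  assumes "finite V"
  shows "AE y in PiM V (\<lambda>_. unif). inj_on y V"
proof -
  have "AE y in PiM V (\<lambda>_. unif). \<forall>a\<in>V. \<forall>b\<in>V. a \<noteq> b \<longrightarrow> y a \<noteq> y b"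
    using assms AE_unif_PiM_neq[OF assms] by (auto intro!: AE_finite_allI)
  then show ?thesis by (rule AE_mp) (auto simp: inj_on_def)
qed

context simple_graph
begin

lemma integrable_gain_PiM:
  assumes "a \<in> V"
  shows "integrable (PiM V (\<lambda>_. unif)) (\<lambda>y. gain evs y a)"
proof -
  interpret P: prob_space "PiM V (\<lambda>_. unif)" by (rule prob_space_PiM) (rule prob_unif)
  show ?thesis
    by (rule P.integrable_const_bound[where B = "3 * (1 + real (card V))\<^sup>2"])
      (use gain_measurable[OF measurable_component_unif assms] gain_nonneg gain_bound in auto)
qed

text \<open>The ranks of \<open>v\<close> and \<open>u\<close> are split off the product one after
  the other. For almost all choices of the remaining ranks, namely distinct ones, the inner double
  integral is bounded by \<open>integral_edge_gain\<close>.\<close>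

lemma integral_gain_edge:
  assumes dl: "\<And>c. c \<in> V \<Longrightarrow> Deadline c \<in> set evs" and uv: "{u, v} \<in> E"
    and evs: "evs = pre @ Deadline u # post" "Deadline v \<notin> set pre" "Deadline u \<notin> set pre"
  shows "5211/10000 \<le> (\<integral>y. gain evs y u \<partial>PiM V (\<lambda>_. unif)) + (\<integral>y. gain evs y v \<partial>PiM V (\<lambda>_. unif))"
proof -
  define W where "W = V - {u, v}"
  have uvV: "u \<in> V" "v \<in> V" "u \<noteq> v" using edge_ends[OF uv] by auto
  have V: "V = insert v (insert u W)" "finite W" "u \<notin> W" "v \<notin> insert u W" "finite (insert u W)"
    using uvV finV by (auto simp: W_def)
  interpret W: prob_space "PiM W (\<lambda>_. unif)" by (rule prob_space_PiM) (rule prob_unif)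
  interpret uW: prob_space "PiM (insert u W) (\<lambda>_. unif)" by (rule prob_space_PiM) (rule prob_unif)
  let ?f = "\<lambda>y. gain evs y u + gain evs y v"
  let ?B = "6 * (1 + real (card V))\<^sup>2"
  have fB: "\<bar>?f y\<bar> \<le> ?B" for y
    using gain_nonneg[of evs y u] gain_nonneg[of evs y v] gain_bound[of evs y u] gain_bound[of evs y v] by simp
  have intB: "\<bar>\<integral>x. h x \<partial>unif\<bar> \<le> ?B" if "\<And>x. \<bar>h x\<bar> \<le> ?B" for h :: "real \<Rightarrow> real"
  proof -
    have "\<bar>\<integral>x. h x \<partial>unif\<bar> \<le> (\<integral>x. \<bar>h x\<bar> \<partial>unif)" by (rule integral_abs_bound)
    also have "\<dots> \<le> (\<integral>x. ?B \<partial>unif)" by (rule integral_mono') (use that in auto)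
    finally show ?thesis by (simp add: unif.prob_space[simplified])
  qed
  have fm: "(\<lambda>n. ?f (F n)) \<in> borel_measurable N"
    if "\<And>a. a \<in> V \<Longrightarrow> (\<lambda>n. F n a) \<in> borel_measurable N" for N :: "'n measure" and F
    using gain_measurable[OF that uvV(1)] gain_measurable[OF that uvV(2)] by auto
  have m1: "(\<lambda>(y, t). ?f (y(v := t))) \<in> borel_measurable (PiM (insert u W) (\<lambda>_. unif) \<Otimes>\<^sub>M unif)"
    unfolding split_beta
  proof (rule fm)
    fix a assume "a \<in> V"
    then show "(\<lambda>n. ((fst n)(v := snd n)) a) \<in> borel_measurable (PiM (insert u W) (\<lambda>_. unif) \<Otimes>\<^sub>M unif)"
      using measurable_compose[OF measurable_fst measurable_component_unif[of a "insert u W"]] V(1) by (cases "a = v") auto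
  qed
  have m2: "(\<lambda>(p, t). ?f ((fst p)(u := snd p, v := t))) \<in> borel_measurable ((PiM W (\<lambda>_. unif) \<Otimes>\<^sub>M unif) \<Otimes>\<^sub>M unif)"
    unfolding split_beta
  proof (rule fm)
    fix a assume a: "a \<in> V"
    have [measurable]: "(\<lambda>n. fst (fst n) a) \<in> borel_measurable ((PiM W (\<lambda>_. unif) \<Otimes>\<^sub>M unif) \<Otimes>\<^sub>M unif)" if "a \<in> W"
      using measurable_compose[OF measurable_compose[OF measurable_fst measurable_fst] measurable_component_unif[OF that]] .
    show "(\<lambda>n. ((fst (fst n))(u := snd (fst n), v := snd n)) a) \<in> borel_measurable ((PiM W (\<lambda>_. unif) \<Otimes>\<^sub>M unif) \<Otimes>\<^sub>M unif)"
      using a V(1) by (cases "a = v"; cases "a = u") auto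
  qed
  have g: "integrable (PiM (insert u W) (\<lambda>_. unif)) (\<lambda>y. \<integral>t. ?f (y(v := t)) \<partial>unif)"
    by (rule uW.integrable_const_bound[where B = ?B])
      (use intB fB unif.borel_measurable_lebesgue_integral[OF m1] in auto)
  have m3: "(\<lambda>(z, x). \<integral>t. ?f (z(u := x, v := t)) \<partial>unif) \<in> borel_measurable (PiM W (\<lambda>_. unif) \<Otimes>\<^sub>M unif)"
    using unif.borel_measurable_lebesgue_integral[OF m2] by (simp add: split_beta)
  have h: "integrable (PiM W (\<lambda>_. unif)) (\<lambda>z. \<integral>x. \<integral>t. ?f (z(u := x, v := t)) \<partial>unif \<partial>unif)"
    by (rule W.integrable_const_bound[where B = ?B])
      (use intB fB unif.borel_measurable_lebesgue_integral[OF m3] in auto)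
  have "(5211/10000::real) = (\<integral>z. 5211/10000 \<partial>PiM W (\<lambda>_. unif))"
    by (simp add: W.prob_space)
  also have "\<dots> \<le> (\<integral>z. \<integral>x. \<integral>t. ?f (z(u := x, v := t)) \<partial>unif \<partial>unif \<partial>PiM W (\<lambda>_. unif))"
  proof (rule integral_mono_AE[OF _ h])
    show "AE z in PiM W (\<lambda>_. unif). 5211/10000 \<le> (\<integral>x. \<integral>t. ?f (z(u := x, v := t)) \<partial>unif \<partial>unif)"
      using AE_unif_PiM_inj[OF V(2)]
    proof eventually_elim
      fix z :: "'v \<Rightarrow> real" assume "inj_on z W"
      then interpret fixed_ranks V E evs z u v pre post
        by unfold_locales (use dl uv evs in \<open>auto simp: W_def\<close>)
      show "5211/10000 \<le> (\<integral>x. \<integral>t. ?f (z(u := x, v := t)) \<partial>unif \<partial>unif)"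
        by (rule integral_edge_gain)
    qed
  qed simp
  also have "\<dots> = (\<integral>y. \<integral>t. ?f (y(v := t)) \<partial>unif \<partial>PiM (insert u W) (\<lambda>_. unif))"
    by (rule unif_prod.product_integral_insert[OF V(2,3) g, symmetric])
  also have "\<dots> = (\<integral>y. ?f y \<partial>PiM V (\<lambda>_. unif))"
    unfolding V(1)
    by (rule unif_prod.product_integral_insert[OF V(5,4), symmetric])
      (use integrable_gain_PiM uvV V(1) in auto)
  also have "\<dots> = (\<integral>y. gain evs y u \<partial>PiM V (\<lambda>_. unif)) + (\<integral>y. gain evs y v \<partial>PiM V (\<lambda>_. unif))"
    by (rule Bochner_Integration.integral_add) (use integrable_gain_PiM uvV in auto)
  finally show ?thesis .
qed

section \<open>From runs with directed pairs back to Ranking\<close>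

text \<open>Both processes apply \<open>arg_min_on\<close> to the same candidate set, so they agree
  for all ranks, ties included.\<close>

lemma ranking_drun:
  assumes "E = edges I"
  shows "fold (ranking_step (edges I) y) evs {} = (\<lambda>(a, p). {a, p}) ` drun E y evs"
proof (induction evs rule: rev_induct)
  case (snoc e evs)
  have "\<Union>((\<lambda>(a, p). {a, p}) ` M) = matched M" for M :: "('v \<times> 'v) set"
    by (force simp: matched_def)
  then show ?case
    using snoc assms by (cases e) (auto simp: Let_def free_nbrs_def)
qed simp

lemma card_ranking:
  assumes "E = edges I"
  shows "card (ranking I y) = card (drun E y (events I))"
proof -
  have "inj_on (\<lambda>(a, p). {a, p}) (drun E y (events I))"
  proof (rule inj_onI, clarify)
    fix a p b q assume "(a, p) \<in> drun E y (events I)" "(b, q) \<in> drun E y (events I)" "{a, p} = {b, q}"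
    then show "a = b \<and> p = q" using drun_matching[of a p y "events I" b q] by auto
  qed
  then show ?thesis unfolding ranking_def ranking_drun[OF assms] by (rule card_image)
qed

end

theorem theorem1:
  "competitive 0.5211 (rank_measure :: 'v fom_input \<Rightarrow> ('v \<Rightarrow> real) measure) ranking"
  unfolding competitive_def
proof (intro allI impI)
  fix I :: "'v fom_input" assume I: "fom_instance I"
  define V E evs where "V = vertices I" and "E = edges I" and "evs = events I"
  let ?P = "PiM V (\<lambda>_. unif)"
  interpret simple_graph V E
    by unfold_locales (use I in \<open>auto simp: fom_instance_def V_def E_def\<close>)
  have dl: "Deadline c \<in> set evs" if "c \<in> V" for c
    using I that by (auto simp: fom_instance_def V_def evs_def)
  have dist: "distinct evs" using I by (simp add: fom_instance_def evs_def)
  define G where "G a = (\<integral>y. gain evs y a \<partial>?P)" for a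
  have G0: "0 \<le> G a" for a
    unfolding G_def by (rule Bochner_Integration.integral_nonneg) (rule gain_nonneg)
  have G_edge: "5211/10000 \<le> (\<Sum>a\<in>e. G a)" if "e \<in> E" for e
  proof -
    have first: "5211/10000 \<le> G a + G b"
      if "{a, b} \<in> E" "evs = pre @ Deadline a # post" "Deadline b \<notin> set pre" for a b pre post
      unfolding G_def
      by (rule integral_gain_edge[OF dl that]) (use dist that in auto)
    obtain a b where e: "e = {a, b}" "a \<noteq> b"
      using edge[OF \<open>e \<in> E\<close>] by (auto simp: card_2_iff)
    have ab: "a \<in> V" "b \<in> V" "{a, b} \<in> E" using edge_ends e \<open>e \<in> E\<close> by auto
    obtain pre post where evs: "evs = pre @ Deadline a # post"
      using dl[OF ab(1)] by (meson split_list)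
    have "5211/10000 \<le> G a + G b"
    proof (cases "Deadline b \<in> set pre")
      case False
      then show ?thesis using first ab evs by blast
    next
      \<comment> \<open>The deadline of \<open>b\<close> comes first, so the two ends exchange
        roles.\<close>
      case True
      then obtain p1 p2 where p: "pre = p1 @ Deadline b # p2" by (meson split_list)
      then have "5211/10000 \<le> G b + G a"
        using first[of b a p1 "p2 @ Deadline a # post"] ab evs dist by (auto simp: insert_commute)
      then show ?thesis by simp
    qed
    then show ?thesis using e by simp
  qed
  have finE: "finite E"
    using edge finV by (meson PowI finite_Pow_iff finite_subset subsetI)
  have fin: "finite (card ` {M. matching E M})" "card ` {M. matching E M} \<noteq> {}"
  proof -
    have "{M. matching E M} \<subseteq> Pow E" by (auto simp: matching_def)
    then show "finite (card ` {M. matching E M})" using finE by (meson finite_Pow_iff finite_imageI finite_subset)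
    show "card ` {M. matching E M} \<noteq> {}" by (auto simp: matching_def intro!: exI[of _ "{}"])
  qed
  obtain Opt where Opt: "matching E Opt" "card Opt = max_matching_size E"
    using Max_in[OF fin] by (auto simp: max_matching_size_def)
  have OptE: "Opt \<subseteq> E" and disj: "pairwise disjnt Opt" using Opt(1) by (auto simp: matching_def)
  have "0.5211 * real (max_matching_size E) = (\<Sum>e\<in>Opt. 5211/10000)"
    using Opt(2) by simp
  also have "\<dots> \<le> (\<Sum>e\<in>Opt. \<Sum>a\<in>e. G a)"
    by (rule sum_mono) (use G_edge OptE in auto)
  \<comment> \<open>Edges of a matching are disjoint, so no vertex is counted twice; nonnegative
    gains then extend the sum to all of \<open>V\<close>.\<close>
  also have "\<dots> = (\<Sum>a\<in>\<Union>Opt. G a)"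
  proof (rule sum.Union_disjoint[symmetric, unfolded comp_def])
    show "\<forall>e\<in>Opt. finite e" using OptE edge finV by (meson finite_subset subsetD)
    show "\<forall>e\<in>Opt. \<forall>f\<in>Opt. e \<noteq> f \<longrightarrow> e \<inter> f = {}"
      using disj by (auto simp: pairwise_def disjnt_def)
  qed
  also have "\<dots> \<le> (\<Sum>a\<in>V. G a)"
    by (rule sum_mono2) (use finV OptE edge G0 in auto)
  also have "\<dots> = (\<integral>y. (\<Sum>a\<in>V. gain evs y a) \<partial>?P)"
    unfolding G_def by (rule Bochner_Integration.integral_sum[symmetric]) (rule integrable_gain_PiM)
  also have "\<dots> = (\<integral>y. real (card (ranking I y)) \<partial>?P)"
  proof (rule integral_cong_AE)
    show "(\<lambda>y. \<Sum>a\<in>V. gain evs y a) \<in> borel_measurable ?P"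
      by (rule borel_measurable_sum) (rule gain_measurable[OF measurable_component_unif])
    \<comment> \<open>A finite sum over the possible runs, which reduces measurability to
      \<open>pred_drun_eq\<close>.\<close>
    have "(\<lambda>y. real (card (drun E y evs))) = (\<lambda>y. \<Sum>M\<in>Pow (V \<times> V). if drun E y evs = M then real (card M) else 0)"
    proof
      fix y
      have "drun E y evs \<in> Pow (V \<times> V)" using drun_V[of _ _ y evs] by auto
      then show "real (card (drun E y evs)) = (\<Sum>M\<in>Pow (V \<times> V). if drun E y evs = M then real (card M) else 0)"
        using finV by (simp add: sum.delta')
    qed
    moreover have "(\<lambda>y. \<Sum>M\<in>Pow (V \<times> V). if drun E y evs = M then real (card M) else 0) \<in> borel_measurable ?P"
      by (intro borel_measurable_sum measurable_If measurable_const) (use pred_drun_eq[of "\<lambda>y. y" ?P evs] measurable_component_unif in auto)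
    ultimately show "(\<lambda>y. real (card (ranking I y))) \<in> borel_measurable ?P"
      using card_ranking[of I] by (simp add: E_def evs_def)
    \<comment> \<open>Distinct ranks, needed for \<open>sum_gain\<close>, hold only almost
      surely.\<close>
    show "AE y in ?P. (\<Sum>a\<in>V. gain evs y a) = real (card (ranking I y))"
      using AE_unif_PiM_inj[OF finV]
      by eventually_elim (use sum_gain card_ranking[of I] in \<open>simp add: E_def evs_def\<close>)
  qed
  finally show "0.5211 * real (max_matching_size (edges I)) \<le> (\<integral>\<omega>. real (card (ranking I \<omega>)) \<partial>rank_measure I)"
    by (simp add: rank_measure_def V_def E_def)
qed

end
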